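(* Fix a real number $b\ge 0$. For all finite simple graphs $G=(V,E)$ such that $\Theta(G)\le b$ and for all positive weight functions $w\in\mathbb R_{>0}^V$, there is a probability distribution $\mu$ on $\mathcal I(G)$ such that, for all $v\in V$, $$\mu(v)\ge f_{b+1}(d_w(v)).$$
   Context: All graphs are finite and simple. $N(v)$ is the set of neighbors of $v$. $\mathcal I(G)$ is the set of independent sets of $G$, including $\emptyset$. For a distribution $\mu$ on $\mathcal I(G)$, $\mu(v)=\mathbb P_{\mathbf I\sim\mu}(v\in\mathbf I)$. For positive weights $w$ and $S\subseteq V$ write $w(S)=\sum_{x\in S}w(x)$; the weighted degree is $d_w(v)=w(N(v))/w(v)$. For a graph $H=(A,F)$ and $w\in\mathbb R_{>0}^A$, let $$T_H(w)=\sum_{\{x,y,z\}\in\mathcal T(H)}w(x)w(y)w(z),\qquad D_H(w)=\sum_{xy\in F}w(x)w(y)(w(x)+w(y)),$$ where $\mathcal T(H)$ is the set of unordered triangles of $H$. The triangle density parameter of $G=(V,E)$ is $$\Theta(G)=\max_{A\subseteq V}\ \sup_{w\in\mathbb R_{>0}^{A}}\begin{cases}6T_{G[A]}(w)/D_{G[A]}(w),&D_{G[A]}(w)>0,\\0,&D_{G[A]}(w)=0.\end{cases}$$ For $m\ge1$, $f_m:[0,\infty)\to(0,1]$ is defined by $f_m(0)=1$ and, for $x>0$, $$f_m(x)=\int_0^1\frac{(1-t)^{1/m}}{m+(x-m)t}\,dt.$$ *)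

theory Defs
  imports "HOL-Probability.Probability"
begin

definition simple_graph :: "'a set \<Rightarrow> 'a set set \<Rightarrow> bool" where
  "simple_graph V E \<longleftrightarrow> finite V \<and> (\<forall>e\<in>E. e \<subseteq> V \<and> card e = 2)"

definition neighbors :: "'a set set \<Rightarrow> 'a \<Rightarrow> 'a set" where
  "neighbors E v = {u. {u, v} \<in> E}"

definition independent_sets :: "'a set \<Rightarrow> 'a set set \<Rightarrow> 'a set set" where
  "independent_sets V E = {I. I \<subseteq> V \<and> (\<forall>x\<in>I. \<forall>y\<in>I. {x, y} \<notin> E)}"

definition weighted_degree :: "'a set set \<Rightarrow> ('a \<Rightarrow> real) \<Rightarrow> 'a \<Rightarrow> real" where
  "weighted_degree E w v = sum w (neighbors E v) / w v"

definition induced_edges :: "'a set set \<Rightarrow> 'a set \<Rightarrow> 'a set set" where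
  "induced_edges E A = {e\<in>E. e \<subseteq> A}"

definition triangles :: "'a set \<Rightarrow> 'a set set \<Rightarrow> 'a set set" where
  "triangles A F = {{x, y, z} | x y z. x \<in> A \<and> y \<in> A \<and> z \<in> A \<and>
     x \<noteq> y \<and> y \<noteq> z \<and> x \<noteq> z \<and> {x, y} \<in> F \<and> {y, z} \<in> F \<and> {x, z} \<in> F}"

definition triangle_weight :: "'a set \<Rightarrow> 'a set set \<Rightarrow> ('a \<Rightarrow> real) \<Rightarrow> real" where
  "triangle_weight A F w = (\<Sum>t\<in>triangles A F. \<Prod>x\<in>t. w x)"

text \<open>For an edge \<open>e = {x, y}\<close> the summand is \<open>w x * w y * (w x + w y)\<close>.\<close>

definition edge_weight :: "'a set set \<Rightarrow> ('a \<Rightarrow> real) \<Rightarrow> real" where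
  "edge_weight F w = (\<Sum>e\<in>F. (\<Prod>x\<in>e. w x) * (\<Sum>x\<in>e. w x))"

definition triangle_ratio :: "'a set \<Rightarrow> 'a set set \<Rightarrow> ('a \<Rightarrow> real) \<Rightarrow> real" where
  "triangle_ratio A F w =
     (if edge_weight F w > 0 then 6 * triangle_weight A F w / edge_weight F w else 0)"

text \<open>
  The supremum is taken in the extended reals, so that it is a genuine least upper bound
  without a side condition on boundedness. Only the values of a weight on \<open>A\<close> matter, so
  positive weights on \<open>A\<close> are represented by total functions that are positive on \<open>A\<close>.
\<close>

definition triangle_density :: "'a set \<Rightarrow> 'a set set \<Rightarrow> ereal" where
  "triangle_density V E =
     Max ((\<lambda>A. SUP w \<in> A \<rightarrow> {0<..}. ereal (triangle_ratio A (induced_edges E A) w)) ` Pow V)"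

definition indep_fun :: "real \<Rightarrow> real \<Rightarrow> real" where
  "indep_fun m x = (if x = 0 then 1
            else integral {0..1} (\<lambda>t. (1 - t) powr (1 / m) / (m + (x - m) * t)))"

end

theory Submission
  imports Defs
begin

text \<open>
  Write \<open>f = indep_fun (b + 1)\<close>, \<open>g = - f'\<close>, \<open>a\<close> for the adjacency matrix, and
  \<open>N v = (\<Sum>x. a v x * w x)\<close>, so that the weighted degree of \<open>v\<close> is \<open>N v / w v\<close>.

  By a minimax argument (\<open>coverage_from_weighted_sets\<close>) the distribution exists as soon as, for
  every \<open>y \<ge> 0\<close>, some independent set has \<open>y\<close>-weight at least
  \<open>F w = (\<Sum>v. y v * f (N v / w v))\<close>. Let \<open>\<alpha>\<close> be the largest \<open>y\<close>-weight of an
  independent set. Since \<open>\<alpha>\<close> does not involve \<open>w\<close>, the bound \<open>F w \<le> \<alpha>\<close> is proved for all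
  positive \<open>w\<close> simultaneously, by induction on the vertex set, and in the induction step \<open>w\<close> may be
  exchanged for any weight with a larger value of \<open>F\<close>.

  For the induction step a vertex \<open>u\<close> is picked with probability proportional to \<open>w u\<close>, and its
  closed neighbourhood is deleted. Convexity of \<open>f\<close> bounds the rate of each survivor from below by
  a tangent line, and the differential equation
  \<open>(x + 1) * f x - x * (x - (b + 1)) * g x = 1\<close> turns the average gain into the
  expression
  \<open>b * (\<Sum>x y. a x y * s x * w x ^ 2 * w y) - (\<Sum>x y z. a x y * a x z * a y z * s x * w x * w y * w z)
    - (\<Sum>x. N x * \<gamma> x)\<close>
  where \<open>s v = y v * g (N v / w v) / w v ^ 2\<close> and
  \<open>\<gamma> x = (\<Sum>v. a x v * w x * w v * (s x - s v))\<close>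
  (\<open>averaged_survivors\<close>, \<open>averaging_in_flow_form\<close>). The point of this form is that \<open>\<gamma> x\<close>
  is exactly the derivative of \<open>F\<close> with respect to \<open>ln (w x)\<close>
  (\<open>rate_sum_has_derivative\<close>). At a critical point of \<open>F\<close> the numbers \<open>\<gamma> x\<close> vanish; they are
  the net flows out of the vertices of a flow that runs downhill for the potential \<open>s\<close>, so \<open>s\<close>
  is constant on every connected component. The triangle density hypothesis, applied to the
  components, then makes the expression nonnegative.

  The function \<open>F\<close> is bounded but need not attain its supremum, so a critical point is replaced by
  a maximum of \<open>F\<close> minus a small multiple of \<open>\<Sum>x. ln (w x) ^ 2\<close>, where all \<open>\<gamma> x\<close> are
  small (\<open>near_critical_weight\<close>). Then \<open>s\<close> is only nearly constant along edges, in the sense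
  that every single edge carries little flow (\<open>edge_flow_bound\<close>). This allows \<open>s x\<close> to be
  replaced by the minimum of \<open>s\<close> over the triangle or edge, and for these minima the triangle
  density hypothesis applies to each superlevel set of \<open>s\<close> separately
  (\<open>triangle_bound_layered\<close>).
\<close>

section \<open>The rate function\<close>

definition rate_kernel :: "real \<Rightarrow> real \<Rightarrow> real \<Rightarrow> real" where
  "rate_kernel m x t = (1 - t) powr (1 / m) / (m + (x - m) * t)"

text \<open>
  Minus the derivative of the rate kernel with respect to \<open>x\<close>.
\<close>

definition slope_kernel :: "real \<Rightarrow> real \<Rightarrow> real \<Rightarrow> real" where
  "slope_kernel m x t = (1 - t) powr (1 / m) * t / (m + (x - m) * t)\<^sup>2"

text \<open>
  Minus the derivative of \<open>indep_fun m\<close> at \<open>x > 0\<close>. The value at \<open>0\<close>, where the integral may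
  diverge, is chosen so that \<open>indep_fun_tangent\<close> and \<open>indep_fun_ode\<close> remain true at isolated
  vertices.
\<close>

definition indep_slope :: "real \<Rightarrow> real \<Rightarrow> real" where
  "indep_slope m x = (if x = 0 then 0 else integral {0..1} (slope_kernel m x))"

lemma kernel_denominator_pos:
  fixes m x t :: real
  assumes "m > 0" "x > 0" "t \<in> {0..1}"
  shows "m + (x - m) * t > 0"
proof -
  have eq: "m + (x - m) * t = m * (1 - t) + x * t" by (simp add: algebra_simps)
  show ?thesis
  proof (cases "t = 0")
    case False
    then have "x * t > 0" "m * (1 - t) \<ge> 0" using assms by auto
    then show ?thesis unfolding eq by linarith
  qed (use assms in auto)
qed

lemma kernel_denominator_nonneg:
  fixes m x t :: real
  assumes "m > 0" "x \<ge> 0" "t \<in> {0..1}"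
  shows "m + (x - m) * t \<ge> 0"
proof -
  have eq: "m + (x - m) * t = m * (1 - t) + x * t" by (simp add: algebra_simps)
  show ?thesis unfolding eq using assms by (intro add_nonneg_nonneg mult_nonneg_nonneg) auto
qed

text \<open>
  At \<open>x = 0\<close> the kernel is \<open>(1 - t) powr (1 / m - 1) / m\<close>, which is unbounded for \<open>m > 1\<close>
  but has an explicit antiderivative. So the prescribed value \<open>indep_fun m 0 = 1\<close> is also given by
  the integral formula, and inequalities between kernels integrate to inequalities that include \<open>0\<close>.
\<close>

lemma rate_kernel_zero_has_integral:
  fixes m :: real
  assumes "m > 0"
  shows "(rate_kernel m 0 has_integral 1) {0..1}"
proof -
  have "(rate_kernel m 0 has_integral
      (- ((1 - 1) powr (1 / m)) - (- ((1 - 0) powr (1 / m))))) {0..1}"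
  proof (rule fundamental_theorem_of_calculus_interior)
    show "continuous_on {0..1} (\<lambda>t. - ((1 - t) powr (1 / m)))"
      using assms by (intro continuous_intros continuous_on_powr') auto
    fix t :: real assume t: "t \<in> {0<..<1}"
    have "((\<lambda>t. - ((1 - t) powr (1 / m))) has_real_derivative
        (1 / m) * (1 - t) powr (1 / m - 1)) (at t)"
      using t assms by (auto intro!: derivative_eq_intros)
    also have "(1 / m) * (1 - t) powr (1 / m - 1) = rate_kernel m 0 t"
      using t powr_diff[of "1 - t" "1 / m" 1] by (simp add: rate_kernel_def) (simp add: algebra_simps)
    finally show "((\<lambda>t. - ((1 - t) powr (1 / m))) has_vector_derivative rate_kernel m 0 t) (at t)"
      by (simp add: has_real_derivative_iff_has_vector_derivative)
  qed auto
  then show ?thesis using assms by simp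
qed

lemma rate_kernel_continuous:
  fixes m x :: real
  assumes "m > 0" "x > 0"
  shows "continuous_on {0..1} (rate_kernel m x)"
  unfolding rate_kernel_def
  using assms kernel_denominator_pos[OF assms]
  by (intro continuous_intros continuous_on_powr') force+

lemma slope_kernel_continuous:
  fixes m x :: real
  assumes "m > 0" "x > 0"
  shows "continuous_on {0..1} (slope_kernel m x)"
  unfolding slope_kernel_def
  using assms kernel_denominator_pos[OF assms]
  by (intro continuous_intros continuous_on_powr') force+

lemma rate_kernel_has_integral:
  fixes m x :: real
  assumes "m > 0" "x \<ge> 0"
  shows "(rate_kernel m x has_integral indep_fun m x) {0..1}"
proof (cases "x = 0")
  case True
  then show ?thesis using rate_kernel_zero_has_integral[OF assms(1)] by (simp add: indep_fun_def)
next
  case False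
  then have "rate_kernel m x integrable_on {0..1}"
    using rate_kernel_continuous assms by (intro integrable_continuous_interval) auto
  moreover have "indep_fun m x = integral {0..1} (rate_kernel m x)"
    using False by (simp add: indep_fun_def rate_kernel_def[abs_def])
  ultimately show ?thesis by (simp add: has_integral_integral)
qed

lemma slope_kernel_has_integral:
  fixes m x :: real
  assumes "m > 0" "x > 0"
  shows "(slope_kernel m x has_integral indep_slope m x) {0..1}"
proof -
  have "slope_kernel m x integrable_on {0..1}"
    using slope_kernel_continuous assms by (intro integrable_continuous_interval) auto
  then show ?thesis using assms by (simp add: indep_slope_def has_integral_integral)
qed

lemma indep_fun_nonneg:
  fixes m x :: real
  assumes "m > 0" "x \<ge> 0"
  shows "indep_fun m x \<ge> 0"
  using has_integral_nonneg[OF rate_kernel_has_integral[OF assms]] kernel_denominator_nonneg[OF assms]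
  by (simp add: rate_kernel_def)

lemma indep_slope_nonneg:
  fixes m x :: real
  assumes "m > 0" "x \<ge> 0"
  shows "indep_slope m x \<ge> 0"
proof (cases "x = 0")
  case False
  then show ?thesis
    using has_integral_nonneg[OF slope_kernel_has_integral[of m x]] assms
    by (simp add: slope_kernel_def)
qed (simp add: indep_slope_def)

lemma reciprocal_tangent:
  fixes p q :: real
  assumes "p > 0" "q > 0"
  shows "1 / p + (p - q) / p\<^sup>2 \<le> 1 / q"
proof -
  have "1 / q - (1 / p + (p - q) / p\<^sup>2) = (p - q)\<^sup>2 / (q * p\<^sup>2)"
    using assms by (simp add: field_simps power2_eq_square)
  also have "\<dots> \<ge> 0" using assms by simp
  finally show ?thesis by simp
qed

text \<open>
  For fixed \<open>t\<close> the kernel is a nonnegative multiple of the reciprocal of an affine function of \<open>x\<close>,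
  hence convex; the tangent inequality for reciprocals is integrated.
\<close>

lemma indep_fun_tangent:
  fixes m x d :: real
  assumes m: "m > 0" and "x \<ge> 0" and d: "0 \<le> d" "d \<le> x"
  shows "indep_fun m x + d * indep_slope m x \<le> indep_fun m (x - d)"
proof (cases "x = 0")
  case True
  then show ?thesis using d by simp
next
  case False
  with assms have x: "x > 0" by simp
  have pt: "rate_kernel m x t + d * slope_kernel m x t \<le> rate_kernel m (x - d) t"
    if t: "t \<in> {0..1}" for t
  proof (cases "t = 1")
    case True
    then show ?thesis using m by (simp add: rate_kernel_def slope_kernel_def)
  next
    case False
    with t have t': "0 \<le> t" "t < 1" by auto
    define p where "p = m + (x - m) * t"
    define q where "q = m + (x - d - m) * t"
    have p: "p > 0" using kernel_denominator_pos[OF m x t] by (simp add: p_def)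
    have "q = m * (1 - t) + (x - d) * t" by (simp add: q_def algebra_simps)
    moreover have "m * (1 - t) > 0" "(x - d) * t \<ge> 0" using t' m d by auto
    ultimately have q: "q > 0" by linarith
    have pq: "d * t = p - q" by (simp add: p_def q_def algebra_simps)
    have "rate_kernel m x t + d * slope_kernel m x t
        = (1 - t) powr (1 / m) * (1 / p + (d * t) / p\<^sup>2)"
      unfolding rate_kernel_def slope_kernel_def p_def[symmetric] by (simp add: algebra_simps)
    also have "\<dots> \<le> (1 - t) powr (1 / m) * (1 / q)"
      unfolding pq using reciprocal_tangent[OF p q] by (intro mult_left_mono) auto
    also have "\<dots> = rate_kernel m (x - d) t" by (simp add: rate_kernel_def q_def)
    finally show ?thesis .
  qed
  have "((\<lambda>t. rate_kernel m x t + d * slope_kernel m x t) has_integral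
      (indep_fun m x + d * indep_slope m x)) {0..1}"
    using rate_kernel_has_integral[OF m, of x] slope_kernel_has_integral[OF m x] x
    by (intro has_integral_add has_integral_mult_right) auto
  from has_integral_le[OF this rate_kernel_has_integral[OF m, of "x - d"] pt] d
  show ?thesis by simp
qed

lemma indep_fun_le_1:
  fixes m x :: real
  assumes "m > 0" "x \<ge> 0"
  shows "indep_fun m x \<le> 1"
proof -
  have "indep_fun m x + x * indep_slope m x \<le> indep_fun m 0"
    using indep_fun_tangent[of m x x] assms by simp
  moreover have "x * indep_slope m x \<ge> 0" using indep_slope_nonneg[OF assms] assms by simp
  moreover have "indep_fun m 0 = 1" by (simp add: indep_fun_def)
  ultimately show ?thesis by linarith
qed

text \<open>
  The combination of kernels on the left is the \<open>t\<close>-derivative of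
  \<open>- m * (1 - t) powr (1 / m + 1) / (m + (x - m) * t)\<close>, which runs from \<open>-1\<close> to \<open>0\<close>.
\<close>

lemma indep_fun_ode:
  fixes m x :: real
  assumes m: "m > 0" and x: "x \<ge> 0"
  shows "(x + 1) * indep_fun m x - x * (x - m) * indep_slope m x = 1"
proof (cases "x = 0")
  case True
  then show ?thesis by (simp add: indep_fun_def)
next
  case False
  with x have x: "x > 0" by simp
  define P where "P t = - m * (1 - t) powr (1 / m + 1) / (m + (x - m) * t)" for t
  let ?k = "\<lambda>t. (x + 1) * rate_kernel m x t - x * (x - m) * slope_kernel m x t"
  have "(?k has_integral (P 1 - P 0)) {0..1}"
  proof (rule fundamental_theorem_of_calculus_interior)
    have "continuous_on {0..1} (\<lambda>t. - m * (1 - t) * rate_kernel m x t)"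
      by (intro continuous_intros rate_kernel_continuous m x)
    then show "continuous_on {0..1} P"
      by (rule continuous_on_eq) (auto simp: P_def rate_kernel_def powr_add)
    fix t :: real assume t: "t \<in> {0<..<1}"
    define D where "D = m + (x - m) * t"
    define r where "r = (1 - t) powr (1 / m)"
    have D: "D > 0" using kernel_denominator_pos[OF m x, of t] t by (simp add: D_def)
    have r1: "(1 - t) powr (1 / m + 1) = r * (1 - t)"
      using t by (simp add: r_def powr_add)
    have "(P has_real_derivative
        ((m + 1) * r * D + m * (r * (1 - t)) * (x - m)) / D\<^sup>2) (at t)"
    proof -
      have num: "((\<lambda>t. - m * (1 - t) powr (1 / m + 1)) has_real_derivative (m + 1) * r) (at t)"
        using t m by (auto intro!: derivative_eq_intros simp: r_def field_simps)
      have den: "((\<lambda>t. m + (x - m) * t) has_real_derivative x - m) (at t)"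
        by (auto intro!: derivative_eq_intros)
      have "m + (x - m) * t \<noteq> 0" using D by (simp add: D_def)
      from DERIV_divide[OF num den this]
      show ?thesis unfolding P_def r1 D_def[symmetric] by (simp add: power2_eq_square)
    qed
    also have "((m + 1) * r * D + m * (r * (1 - t)) * (x - m)) / D\<^sup>2
        = ((x + 1) * r * D - x * (x - m) * (r * t)) / D\<^sup>2"
      by (rule arg_cong[where f="\<lambda>z. z / D\<^sup>2"]) (simp add: D_def algebra_simps)
    also have "\<dots> = ?k t"
      unfolding rate_kernel_def slope_kernel_def r_def[symmetric] D_def[symmetric]
      using D by (simp add: field_simps power2_eq_square)
    finally show "(P has_vector_derivative ?k t) (at t)"
      by (simp add: has_real_derivative_iff_has_vector_derivative)
  qed auto
  moreover have "P 1 - P 0 = 1" using m by (simp add: P_def)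
  moreover have "(?k has_integral ((x + 1) * indep_fun m x - x * (x - m) * indep_slope m x)) {0..1}"
    using rate_kernel_has_integral[OF m, of x] slope_kernel_has_integral[OF m x] x
    by (intro has_integral_diff has_integral_mult_right) auto
  ultimately show ?thesis by (metis has_integral_unique)
qed

lemma indep_fun_has_derivative:
  fixes m x :: real
  assumes m: "m > 0" and x: "x > 0"
  shows "(indep_fun m has_real_derivative - indep_slope m x) (at x)"
proof -
  have U: "open {0::real<..}" by auto
  have "((\<lambda>x. integral (cbox 0 1) (rate_kernel m x)) has_field_derivative
      integral (cbox 0 1) (\<lambda>t. - slope_kernel m x t)) (at x within {0<..})"
  proof (rule leibniz_rule_field_derivative[where U="{0<..}"])
    fix z t :: real assume z: "z \<in> {0<..}" and t: "t \<in> cbox 0 1"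
    have D: "m + (z - m) * t > 0" using kernel_denominator_pos[OF m, of z t] z t by simp
    show "((\<lambda>x. rate_kernel m x t) has_field_derivative - slope_kernel m z t) (at z within {0<..})"
    proof -
      have den: "((\<lambda>z. m + (z - m) * t) has_real_derivative t) (at z within {0<..})"
        by (auto intro!: derivative_eq_intros)
      have "m + (z - m) * t \<noteq> 0" using D by simp
      from DERIV_divide[OF DERIV_const den this, of "(1 - t) powr (1 / m)"]
      show ?thesis unfolding rate_kernel_def slope_kernel_def by (simp add: power2_eq_square)
    qed
  next
    fix z :: real assume "z \<in> {0<..}"
    then show "rate_kernel m z integrable_on cbox 0 1"
      using rate_kernel_has_integral[OF m, of z] by auto
  next
    have *: "m + (z - m) * t \<noteq> 0" if "z \<in> {0<..}" "t \<in> cbox 0 1" for z t :: real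
      using kernel_denominator_pos[OF m, of z t] that by simp
    have "continuous_on ({0<..} \<times> cbox 0 1) 
       (\<lambda>p. - ((1 - snd p) powr (1 / m) * snd p / (m + (fst p - m) * snd p)\<^sup>2))"
      using m * by (intro continuous_intros continuous_on_powr') auto
    then show "continuous_on ({0<..} \<times> cbox 0 1) (\<lambda>(x, t). - slope_kernel m x t)"
      by (simp add: slope_kernel_def case_prod_beta)
  qed (use x in auto)
  moreover have "integral (cbox 0 1) (\<lambda>t. - slope_kernel m x t) = - indep_slope m x"
    using x by (simp add: indep_slope_def)
  ultimately have "((\<lambda>x. integral (cbox 0 1) (rate_kernel m x)) has_real_derivative
      - indep_slope m x) (at x)"
    using at_within_open[OF _ U, of x] x by simp
  then show ?thesis
  proof (rule has_field_derivative_transform_within_open[OF _ U])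
    fix z :: real assume "z \<in> {0<..}"
    then show "integral (cbox 0 1) (rate_kernel m z) = indep_fun m z"
      using rate_kernel_has_integral[OF m, of z] by (simp add: integral_unique)
  qed (use x in simp)
qed

section \<open>From weighted sums over independent sets to a distribution\<close>

lemma compact_real_box_functions:
  fixes l u :: "'i \<Rightarrow> real"
  shows "compact (Pi UNIV (\<lambda>i. {l i..u i}))"
proof -
  have "compactin (product_topology (\<lambda>i. euclidean) UNIV) (PiE UNIV (\<lambda>i. {l i..u i}))"
    by (simp add: compactin_PiE)
  then show ?thesis by (simp add: euclidean_product_topology PiE_UNIV_domain)
qed

definition simplex_on :: "'b set \<Rightarrow> ('b \<Rightarrow> real) set" where
  "simplex_on S = {p. (\<forall>i\<in>S. 0 \<le> p i) \<and> (\<forall>i. i \<notin> S \<longrightarrow> p i = 0) \<and> sum p S = 1}"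

lemma compact_simplex_on:
  fixes S :: "'b set"
  assumes "finite S"
  shows "compact (simplex_on S)"
proof -
  let ?B = "Pi UNIV (\<lambda>i. {0..(if i \<in> S then 1 else 0 :: real)})"
  have "closed {p :: 'b \<Rightarrow> real. sum p S = 1}"
    by (intro closed_Collect_eq continuous_intros continuous_on_product_coordinates)
  then have "compact (?B \<inter> {p. sum p S = 1})"
    by (rule compact_Int_closed[OF compact_real_box_functions])
  also have "?B \<inter> {p. sum p S = 1} = simplex_on S"
  proof (intro equalityI subsetI)
    fix p assume p: "p \<in> simplex_on S"
    have "p i \<in> {0..(if i \<in> S then 1 else 0)}" for i
    proof (cases "i \<in> S")
      case True
      then have "p i \<le> sum p S" using p assms by (intro member_le_sum) (auto simp: simplex_on_def)
      then show ?thesis using p True by (auto simp: simplex_on_def)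
    qed (use p in \<open>auto simp: simplex_on_def\<close>)
    then show "p \<in> ?B \<inter> {p. sum p S = 1}" using p by (auto simp: simplex_on_def)
  next
    fix p assume p: "p \<in> ?B \<inter> {p. sum p S = 1}"
    have "p i \<in> {0..(if i \<in> S then 1 else 0)}" for i using p by (auto simp: Pi_iff)
    then have "0 \<le> p i" "i \<notin> S \<Longrightarrow> p i = 0" for i by (metis atLeastAtMost_iff, smt (verit) atLeastAtMost_iff)
    then show "p \<in> simplex_on S" using p by (auto simp: simplex_on_def)
  qed
  finally show ?thesis .
qed

lemma pmf_of_simplex:
  assumes fin: "finite S" and p: "p \<in> simplex_on S"
  shows "\<exists>\<mu>. set_pmf \<mu> \<subseteq> S \<and> (\<forall>Q. measure_pmf.prob \<mu> Q = (\<Sum>i\<in>S. p i * of_bool (i \<in> Q)))"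
proof -
  define \<mu> where "\<mu> = embed_pmf p"
  have nonneg: "0 \<le> p i" for i using p by (cases "i \<in> S") (auto simp: simplex_on_def)
  have supp: "{i. p i \<noteq> 0} \<subseteq> S" using p by (auto simp: simplex_on_def)
  have "(\<integral>\<^sup>+ i. ennreal (p i) \<partial>count_space UNIV) = (\<Sum>i\<in>S. ennreal (p i))"
    using fin supp by (intro nn_integral_count_space') force+
  also have "\<dots> = ennreal (sum p S)" using nonneg by (intro sum_ennreal) auto
  also have "\<dots> = 1" using p by (simp add: simplex_on_def)
  finally have pmf: "pmf \<mu> i = p i" for i
    unfolding \<mu>_def using nonneg by (intro pmf_embed_pmf) auto
  have set: "set_pmf \<mu> \<subseteq> S" using supp by (auto simp: set_pmf_iff pmf)
  have "measure_pmf.prob \<mu> Q = (\<Sum>i\<in>S. p i * of_bool (i \<in> Q))" for Q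
  proof -
    have "measure_pmf.prob \<mu> Q = measure_pmf.prob \<mu> (Q \<inter> S)"
      using set by (intro measure_prob_cong_0) (auto simp: pmf_eq_0_set_pmf)
    also have "\<dots> = (\<Sum>i\<in>Q \<inter> S. p i)" using fin by (simp add: measure_measure_pmf_finite pmf)
    also have "\<dots> = (\<Sum>i\<in>S. p i * of_bool (i \<in> Q))"
      using fin by (intro sum.mono_neutral_cong_left) auto
    finally show ?thesis .
  qed
  with set show ?thesis by blast
qed

lemma linear_le_quadratic_nonpos:
  fixes c k :: real
  assumes "\<And>t. 0 < t \<Longrightarrow> t \<le> 1 \<Longrightarrow> t * c \<le> t\<^sup>2 * k"
  shows "c \<le> 0"
proof (rule ccontr)
  assume "\<not> c \<le> 0"
  then have c: "c > 0" by simp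
  define t where "t = min 1 (c / (2 * (\<bar>k\<bar> + 1)))"
  have t: "0 < t" "t \<le> 1" using c by (auto simp: t_def)
  have "t * c \<le> t * (t * k)" using assms[OF t] by (simp add: power2_eq_square algebra_simps)
  then have "c \<le> t * k" using t by simp
  also have "\<dots> \<le> t * (\<bar>k\<bar> + 1)" using t by (intro mult_left_mono) auto
  also have "\<dots> \<le> c / (2 * (\<bar>k\<bar> + 1)) * (\<bar>k\<bar> + 1)" by (intro mult_right_mono) (auto simp: t_def)
  also have "\<dots> = c / 2" by (simp add: field_simps)
  finally show False using c by simp
qed

text \<open>
  A minimax principle, proved by projection: among all mixtures \<open>p\<close> of sets in \<open>\<I>\<close> one
  minimises the squared shortfall \<open>\<Sum>v\<in>V. (max 0 (f v - cov p v)) ^ 2\<close>. The shortfalls \<open>y\<close> of a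
  minimiser serve as weights. If a set \<open>I\<close> has \<open>y\<close>-weight at least \<open>\<Sum>v\<in>V. y v * f v\<close>, then shifting
  mass towards \<open>I\<close> would reduce the loss to first order unless the shortfalls are all zero.
\<close>

lemma coverage_from_weighted_sets:
  fixes f :: "'a \<Rightarrow> real" and \<I> :: "'a set set"
  assumes finV: "finite V" and finI: "finite \<I>"
    and dual: "\<And>y. (\<And>v. 0 \<le> y v) \<Longrightarrow>
      \<exists>I\<in>\<I>. (\<Sum>v\<in>V. y v * f v) \<le> (\<Sum>v\<in>V. y v * of_bool (v \<in> I))"
  shows "\<exists>\<mu>. set_pmf \<mu> \<subseteq> \<I> \<and> (\<forall>v\<in>V. f v \<le> measure_pmf.prob \<mu> {I. v \<in> I})"
proof -
  define cov where "cov p v = (\<Sum>I\<in>\<I>. p I * of_bool (v \<in> I))" for p :: "'a set \<Rightarrow> real" and v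
  define loss where "loss p = (\<Sum>v\<in>V. (max 0 (f v - cov p v))\<^sup>2)" for p
  obtain I0 where I0: "I0 \<in> \<I>" using dual[of "\<lambda>_. 0"] by auto
  have "(\<lambda>I. of_bool (I = I0)) \<in> simplex_on \<I>"
    using I0 finI by (auto simp: simplex_on_def of_bool_def)
  moreover have "continuous_on (simplex_on \<I>) loss"
    unfolding loss_def cov_def
    by (intro continuous_intros continuous_on_subset[OF continuous_on_product_coordinates]) auto
  ultimately obtain p where p: "p \<in> simplex_on \<I>" and
    min: "\<And>r. r \<in> simplex_on \<I> \<Longrightarrow> loss p \<le> loss r"
    using continuous_attains_inf[OF compact_simplex_on[OF finI], of loss] by blast
  define y where "y v = max 0 (f v - cov p v)" for v
  obtain I where I: "I \<in> \<I>" and yI: "(\<Sum>v\<in>V. y v * f v) \<le> (\<Sum>v\<in>V. y v * of_bool (v \<in> I))"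
    using dual[of y] by (auto simp: y_def)
  define \<delta> where "\<delta> v = of_bool (v \<in> I) - cov p v" for v
  \<comment> \<open>first-order optimality of the mixture in the direction of the set \<open>I\<close>\<close>
  have "2 * (\<Sum>v\<in>V. \<delta> v * y v) \<le> 0"
  proof (rule linear_le_quadratic_nonpos[where k = "\<Sum>v\<in>V. (\<delta> v)\<^sup>2"])
    fix t :: real assume t: "0 < t" "t \<le> 1"
    define r where "r J = (1 - t) * p J + t * of_bool (J = I)" for J
    have sum1: "(\<Sum>J\<in>\<I>. of_bool (J = I)) = (1::real)"
      using I finI by (simp add: of_bool_def)
    have "sum r \<I> = (1 - t) * sum p \<I> + t * (\<Sum>J\<in>\<I>. of_bool (J = I))"
      by (simp only: r_def[abs_def] sum.distrib sum_distrib_left)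
    then have "r \<in> simplex_on \<I>"
      using p t I sum1 by (auto simp: simplex_on_def r_def)
    from min[OF this] have "loss p \<le> loss r" .
    also have "loss r \<le> (\<Sum>v\<in>V. (y v - t * \<delta> v)\<^sup>2)"
      unfolding loss_def
    proof (rule sum_mono)
      fix v
      have "(\<Sum>J\<in>\<I>. of_bool (J = I) * of_bool (v \<in> J)) = (of_bool (v \<in> I) :: real)"
        using I finI by (subst sum.remove[of _ I]) (auto intro!: sum.neutral)
      moreover have "cov r v = (1 - t) * cov p v + t * (\<Sum>J\<in>\<I>. of_bool (J = I) * of_bool (v \<in> J))"
        unfolding cov_def r_def
        by (simp only: sum.distrib sum_distrib_left ring_distribs mult.assoc)
      ultimately have "cov r v = cov p v + t * \<delta> v"
        by (simp add: \<delta>_def algebra_simps)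
      then have "max 0 (f v - cov r v) \<le> \<bar>y v - t * \<delta> v\<bar>" by (simp add: y_def)
      then show "(max 0 (f v - cov r v))\<^sup>2 \<le> (y v - t * \<delta> v)\<^sup>2"
        by (metis abs_ge_zero abs_le_square_iff abs_of_nonneg max.cobounded1)
    qed
    also have "\<dots> = (\<Sum>v\<in>V. (y v)\<^sup>2 - t * (2 * (\<delta> v * y v)) + t\<^sup>2 * (\<delta> v)\<^sup>2)"
      by (intro sum.cong refl) (simp add: power2_eq_square algebra_simps)
    also have "\<dots> = loss p - t * (2 * (\<Sum>v\<in>V. \<delta> v * y v)) + t\<^sup>2 * (\<Sum>v\<in>V. (\<delta> v)\<^sup>2)"
      by (simp add: sum.distrib sum_subtractf sum_distrib_left loss_def y_def)
    finally show "t * (2 * (\<Sum>v\<in>V. \<delta> v * y v)) \<le> t\<^sup>2 * (\<Sum>v\<in>V. (\<delta> v)\<^sup>2)" by simp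
  qed
  then have "(\<Sum>v\<in>V. y v * of_bool (v \<in> I)) \<le> (\<Sum>v\<in>V. y v * cov p v)"
    by (simp add: \<delta>_def sum_subtractf algebra_simps)
  with yI have "(\<Sum>v\<in>V. y v * f v) - (\<Sum>v\<in>V. y v * cov p v) \<le> 0" by linarith
  moreover have "(\<Sum>v\<in>V. y v * f v) - (\<Sum>v\<in>V. y v * cov p v) = (\<Sum>v\<in>V. (y v)\<^sup>2)"
    unfolding sum_subtractf[symmetric]
    by (intro sum.cong refl) (auto simp: y_def max_def power2_eq_square algebra_simps)
  ultimately have "(\<Sum>v\<in>V. (y v)\<^sup>2) = 0" by (simp add: sum_nonneg order_antisym)
  then have "y v = 0" if "v \<in> V" for v
    using that finV by (simp add: sum_nonneg_eq_0_iff)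
  then have le: "f v \<le> cov p v" if "v \<in> V" for v
    using that by (force simp: y_def max_def split: if_splits)
  obtain \<mu> where "set_pmf \<mu> \<subseteq> \<I>"
    "\<And>Q. measure_pmf.prob \<mu> Q = (\<Sum>i\<in>\<I>. p i * of_bool (i \<in> Q))"
    using pmf_of_simplex[OF finI p] by blast
  then show ?thesis using le by (intro exI[of _ \<mu>]) (auto simp: cov_def)
qed

section \<open>Deleting the closed neighbourhood of a vertex\<close>

text \<open>
  The adjacency matrix is real valued so that sums over neighbours become matrix expressions. The
  condition \<open>triangle_bound\<close> is the triangle density hypothesis with ordered tuples: each triangle
  occurs six times on the left, and each edge twice on the right.
\<close>

locale weighted_adjacency =
  fixes V :: "'a set" and a :: "'a \<Rightarrow> 'a \<Rightarrow> real" and b :: real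
  assumes finite_V: "finite V"
    and a_01: "a x y = 0 \<or> a x y = 1"
    and a_sym: "a x y = a y x"
    and a_irrefl: "a x x = 0"
    and b_nonneg: "b \<ge> 0"
    and triangle_bound: "\<lbrakk>B \<subseteq> V; \<And>x. x \<in> B \<Longrightarrow> w x > 0\<rbrakk> \<Longrightarrow>
      (\<Sum>x\<in>B. \<Sum>y\<in>B. \<Sum>z\<in>B. a x y * a x z * a y z * (w x * w y * w z))
      \<le> b * (\<Sum>x\<in>B. \<Sum>y\<in>B. a x y * ((w x)\<^sup>2 * w y))"
begin

definition nbr :: "'a set \<Rightarrow> ('a \<Rightarrow> real) \<Rightarrow> 'a \<Rightarrow> real" where
  "nbr A w v = (\<Sum>u\<in>A. a v u * w u)"

definition deg :: "'a set \<Rightarrow> ('a \<Rightarrow> real) \<Rightarrow> 'a \<Rightarrow> real" where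
  "deg A w v = nbr A w v / w v"

definition rate_sum :: "'a set \<Rightarrow> ('a \<Rightarrow> real) \<Rightarrow> ('a \<Rightarrow> real) \<Rightarrow> real" where
  "rate_sum A y w = (\<Sum>v\<in>A. y v * indep_fun (b + 1) (deg A w v))"

definition stable :: "'a set \<Rightarrow> 'a set set" where
  "stable A = {I. I \<subseteq> A \<and> (\<forall>x\<in>I. \<forall>y\<in>I. a x y = 0)}"

definition alpha :: "'a set \<Rightarrow> ('a \<Rightarrow> real) \<Rightarrow> real" where
  "alpha A y = Max (sum y ` stable A)"

text \<open>
  The number \<open>s v\<close> above. With it, the derivative of \<open>rate_sum\<close> in the logarithmic weights is
  \<open>flow\<close>, the net flow out of a vertex when the edge from \<open>x\<close> to \<open>v\<close> carries
  \<open>w x * w v * (s x - s v)\<close>.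
\<close>

definition potential :: "'a set \<Rightarrow> ('a \<Rightarrow> real) \<Rightarrow> ('a \<Rightarrow> real) \<Rightarrow> 'a \<Rightarrow> real" where
  "potential A y w v = y v * indep_slope (b + 1) (deg A w v) / (w v)\<^sup>2"

definition flow :: "'a set \<Rightarrow> ('a \<Rightarrow> real) \<Rightarrow> ('a \<Rightarrow> real) \<Rightarrow> 'a \<Rightarrow> real" where
  "flow A s w x = (\<Sum>v\<in>A. a x v * (w x * w v * (s x - s v)))"

lemma a_nonneg: "a x y \<ge> 0" and a_le_1: "a x y \<le> 1" and a_idem: "a x y * a x y = a x y"
  using a_01[of x y] by auto

lemma b1_pos: "b + 1 > 0" using b_nonneg by simp

lemma nbr_nonneg: "(\<And>x. x \<in> A \<Longrightarrow> w x > 0) \<Longrightarrow> nbr A w v \<ge> 0"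
  unfolding nbr_def by (intro sum_nonneg mult_nonneg_nonneg a_nonneg) (auto intro: less_imp_le)

lemma deg_nonneg: "(\<And>x. x \<in> A \<Longrightarrow> w x > 0) \<Longrightarrow> v \<in> A \<Longrightarrow> deg A w v \<ge> 0"
  unfolding deg_def by (intro divide_nonneg_nonneg nbr_nonneg) (auto intro: less_imp_le)

lemma nbr_le:
  assumes "finite A" "\<And>x. x \<in> A \<Longrightarrow> w x > 0"
  shows "nbr A w v \<le> sum w A"
  unfolding nbr_def
  by (intro sum_mono mult_left_le_one_le a_nonneg a_le_1) (use assms in \<open>auto intro: less_imp_le\<close>)

lemma potential_nonneg:
  assumes "\<And>x. x \<in> A \<Longrightarrow> w x > 0" "v \<in> A" "y v \<ge> 0"
  shows "potential A y w v \<ge> 0"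
  unfolding potential_def using assms indep_slope_nonneg[OF b1_pos deg_nonneg, of A w v] by simp

lemma finite_stable: "finite A \<Longrightarrow> finite (stable A)"
  by (rule finite_subset[of _ "Pow A"]) (auto simp: stable_def)

lemma empty_stable: "{} \<in> stable A" by (simp add: stable_def)

lemma alpha_ge: "finite A \<Longrightarrow> I \<in> stable A \<Longrightarrow> sum y I \<le> alpha A y"
  unfolding alpha_def by (intro Max_ge finite_imageI finite_stable) auto

lemma alpha_attained:
  assumes "finite A"
  obtains I where "I \<in> stable A" "sum y I = alpha A y"
proof -
  have "alpha A y \<in> sum y ` stable A"
    unfolding alpha_def using empty_stable[of A]
    by (intro Max_in finite_imageI finite_stable assms) auto
  then show thesis using that by auto
qed

definition survivors :: "'a set \<Rightarrow> 'a \<Rightarrow> 'a set" where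
  "survivors A u = {v\<in>A. v \<noteq> u \<and> a u v = 0}"

lemma alpha_survivors:
  assumes "finite A" "u \<in> A"
  shows "y u + alpha (survivors A u) y \<le> alpha A y"
proof -
  have fin: "finite (survivors A u)" using assms by (simp add: survivors_def)
  obtain I where I: "I \<in> stable (survivors A u)" "sum y I = alpha (survivors A u) y"
    using alpha_attained[OF fin] .
  have "finite I" "u \<notin> I" using I(1) fin by (auto simp: stable_def survivors_def intro: finite_subset)
  then have "sum y (insert u I) = y u + alpha (survivors A u) y" using I by simp
  moreover have "insert u I \<in> stable A"
    using I(1) assms a_sym a_irrefl by (auto simp: stable_def survivors_def)
  ultimately show ?thesis using alpha_ge[OF assms(1)] by metis
qed

lemma survivor_indicator:
  "v \<in> A \<Longrightarrow> of_bool (v \<in> survivors A u) = 1 - of_bool (u = v) - a u v"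
  using a_01[of u v] a_irrefl[of v] by (auto simp: survivors_def)

lemma deg_survivors:
  assumes A: "finite A" and u: "u \<in> A" and v: "v \<in> survivors A u"
  shows "deg (survivors A u) w v = deg A w v - (\<Sum>x\<in>A. a v x * a u x * w x) / w v"
proof -
  have vu: "a v u = 0" using v a_sym by (auto simp: survivors_def)
  have "nbr (survivors A u) w v = (\<Sum>x\<in>A. a v x * w x * (1 - a u x))"
    unfolding nbr_def
  proof (intro sum.mono_neutral_cong_left ballI)
    fix x assume "x \<in> A - survivors A u"
    then have "x = u \<or> a u x = 1" using a_01[of u x] by (auto simp: survivors_def)
    then show "a v x * w x * (1 - a u x) = 0" using vu by auto
  qed (use A in \<open>auto simp: survivors_def\<close>)
  also have "\<dots> = nbr A w v - (\<Sum>x\<in>A. a v x * a u x * w x)"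
    by (simp add: nbr_def sum_subtractf[symmetric] algebra_simps)
  finally show ?thesis by (simp add: deg_def diff_divide_distrib)
qed

text \<open>
  Deleting the closed neighbourhood of \<open>u\<close> lowers the degree of a survivor \<open>v\<close> by the weight of the
  common neighbours of \<open>u\<close> and \<open>v\<close> relative to \<open>w v\<close>, and the tangent inequality converts this into a
  gain. The factor \<open>1 - of_bool (u = v) - a u v\<close> is the indicator of survival, which makes the sum
  over \<open>v\<close> range over a set independent of \<open>u\<close>.
\<close>

lemma rate_sum_survivors:
  assumes A: "finite A" and u: "u \<in> A"
    and w: "\<And>x. x \<in> A \<Longrightarrow> w x > 0" and y: "\<And>x. x \<in> A \<Longrightarrow> y x \<ge> 0"
  shows "(\<Sum>v\<in>A. (1 - of_bool (u = v) - a u v) *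
      (y v * (indep_fun (b + 1) (deg A w v)
        + (\<Sum>x\<in>A. a v x * a u x * w x) / w v * indep_slope (b + 1) (deg A w v))))
    \<le> rate_sum (survivors A u) y w"
    (is "(\<Sum>v\<in>A. _ * ?t v) \<le> _")
proof -
  have "(\<Sum>v\<in>A. (1 - of_bool (u = v) - a u v) * ?t v)
      = (\<Sum>v\<in>A. of_bool (v \<in> survivors A u) * ?t v)"
    by (intro sum.cong refl) (simp add: survivor_indicator)
  also have "\<dots> = (\<Sum>v\<in>survivors A u. ?t v)"
    using A by (intro sum.mono_neutral_cong_right) (auto simp: survivors_def)
  also have "\<dots> \<le> rate_sum (survivors A u) y w"
    unfolding rate_sum_def
  proof (intro sum_mono mult_left_mono)
    fix v assume v: "v \<in> survivors A u"
    then have vA: "v \<in> A" by (simp add: survivors_def)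
    show "y v \<ge> 0" using y vA by simp
    define d where "d = (\<Sum>x\<in>A. a v x * a u x * w x) / w v"
    have "0 \<le> d" unfolding d_def using w[OF vA] w
      by (intro divide_nonneg_pos sum_nonneg mult_nonneg_nonneg a_nonneg) (auto intro: less_imp_le)
    moreover have "d \<le> deg A w v"
      unfolding d_def deg_def nbr_def using w vA a_nonneg a_le_1
      by (intro divide_right_mono sum_mono mult_right_mono mult_left_le) (auto intro: less_imp_le)
    ultimately show "indep_fun (b + 1) (deg A w v) + d * indep_slope (b + 1) (deg A w v)
        \<le> indep_fun (b + 1) (deg (survivors A u) w v)"
      unfolding deg_survivors[OF A u v] d_def[symmetric]
      using deg_nonneg[OF w vA] by (intro indep_fun_tangent b1_pos) auto
  qed
  finally show ?thesis .
qed

text \<open>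
  The differential equation of the rate function at the weighted degree of \<open>v\<close>, multiplied by
  \<open>y v * w v\<close> to clear the denominators.
\<close>

lemma ode_at_vertex:
  assumes w: "\<And>x. x \<in> A \<Longrightarrow> w x > 0" and v: "v \<in> A"
  shows "y v * (w v - indep_fun (b + 1) (deg A w v) * (w v + nbr A w v))
    = potential A y w v * w v * ((b + 1) * w v * nbr A w v - (nbr A w v)\<^sup>2)"
proof -
  define d where "d = deg A w v"
  define F where "F = indep_fun (b + 1) d"
  define G where "G = indep_slope (b + 1) d"
  have wv: "w v > 0" using w v by simp
  have N: "nbr A w v = w v * d" using wv by (simp add: d_def deg_def)
  have "(d + 1) * F - d * (d - (b + 1)) * G = 1"
    unfolding F_def G_def d_def by (intro indep_fun_ode b1_pos deg_nonneg w v)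
  then have "(d + 1) * F = 1 + d * (d - (b + 1)) * G" by linarith
  then have "y v * (w v * (1 - (d + 1) * F)) = y v * (w v * (- d * (d - (b + 1)) * G))" by simp
  then have "y v * (w v - F * (w v + w v * d)) = y v * w v * G * d * ((b + 1) - d)"
    by (simp add: algebra_simps)
  also have "\<dots> = y v * G / (w v)\<^sup>2 * w v * ((b + 1) * w v * (w v * d) - (w v * d)\<^sup>2)"
    using wv by (simp add: field_simps power2_eq_square)
  finally show ?thesis by (simp add: potential_def N d_def[symmetric] F_def[symmetric] G_def[symmetric])
qed

end

section \<open>Averaging over the deleted vertex\<close>

context weighted_adjacency
begin

text \<open>
  The estimate for deleting around \<open>u\<close>, summed over \<open>u\<close> with weights \<open>w u\<close>. The terms without slope
  collapse by \<open>ode_at_vertex\<close>; the slope terms count paths \<open>v, x, u\<close> whose end \<open>u\<close> survives alongside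
  \<open>v\<close>, that is all paths except the closed ones (\<open>u = v\<close>) and those in triangles. The closed ones
  lower the coefficient of \<open>w v * nbr A w v\<close> from \<open>b + 1\<close> to \<open>b\<close>.
\<close>

lemma averaged_survivors:
  assumes A: "finite A"
    and w: "\<And>x. x \<in> A \<Longrightarrow> w x > 0" and y: "\<And>x. x \<in> A \<Longrightarrow> y x \<ge> 0"
    and IH: "\<And>u. u \<in> A \<Longrightarrow> rate_sum (survivors A u) y w \<le> alpha (survivors A u) y"
  shows "(\<Sum>v\<in>A. potential A y w v * w v * (b * w v * nbr A w v - (nbr A w v)\<^sup>2
      + (\<Sum>x\<in>A. a v x * w x * nbr A w x)
      - (\<Sum>u\<in>A. \<Sum>x\<in>A. a v u * a v x * a u x * (w u * w x))))
    \<le> sum w A * (alpha A y - rate_sum A y w)" (is "?L \<le> _")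
proof -
  define f where "f v = indep_fun (b + 1) (deg A w v)" for v
  define q where "q v = potential A y w v * w v" for v
  define C where "C u v = (\<Sum>x\<in>A. a v x * a u x * w x)" for u v
  define k where "k u v = (1 - of_bool (u = v) - a u v :: real)" for u v
  have slope: "y v * (c / w v * indep_slope (b + 1) (deg A w v)) = q v * c" if "v \<in> A" for v c
    using w[OF that] by (simp add: q_def potential_def power2_eq_square)
  have pick: "w u * y u + (\<Sum>v\<in>A. w u * k u v * (y v * f v + q v * C u v)) \<le> w u * alpha A y"
    if u: "u \<in> A" for u
  proof -
    have "y v * f v + q v * C u v
        = y v * (f v + C u v / w v * indep_slope (b + 1) (deg A w v))" if "v \<in> A" for v
      by (simp only: distrib_left slope[OF that])
    then have "(\<Sum>v\<in>A. k u v * (y v * f v + q v * C u v))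
        = (\<Sum>v\<in>A. k u v * (y v * (f v + C u v / w v * indep_slope (b + 1) (deg A w v))))"
      by (intro sum.cong refl) simp
    also have "\<dots> \<le> rate_sum (survivors A u) y w"
      unfolding k_def f_def C_def by (intro rate_sum_survivors A u w y)
    finally have "(\<Sum>v\<in>A. k u v * (y v * f v + q v * C u v)) \<le> rate_sum (survivors A u) y w" .
    then have "y u + (\<Sum>v\<in>A. k u v * (y v * f v + q v * C u v)) \<le> alpha A y"
      using IH[OF u] alpha_survivors[OF A u, of y] by linarith
    then have "w u * (y u + (\<Sum>v\<in>A. k u v * (y v * f v + q v * C u v))) \<le> w u * alpha A y"
      using w[OF u] by (intro mult_left_mono) auto
    then show ?thesis by (simp add: distrib_left sum_distrib_left mult.assoc)
  qed
  have count: "(\<Sum>u\<in>A. w u * k u v) = sum w A - w v - nbr A w v" if v: "v \<in> A" for v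
  proof -
    have "(\<Sum>u\<in>A. w u * k u v) = sum w A - (\<Sum>u\<in>A. w u * of_bool (u = v)) - (\<Sum>u\<in>A. w u * a u v)"
      by (simp add: k_def right_diff_distrib sum_subtractf)
    also have "(\<Sum>u\<in>A. w u * of_bool (u = v)) = w v"
      using v A by (simp add: of_bool_def if_distrib cong: if_cong)
    also have "(\<Sum>u\<in>A. w u * a u v) = nbr A w v"
      by (simp add: nbr_def a_sym[of _ v] mult.commute)
    finally show ?thesis .
  qed
  have paths: "(\<Sum>u\<in>A. w u * k u v * C u v) = (\<Sum>x\<in>A. a v x * w x * nbr A w x) - w v * nbr A w v
      - (\<Sum>u\<in>A. \<Sum>x\<in>A. a v u * a v x * a u x * (w u * w x))" if v: "v \<in> A" for v
  proof -
    have "(\<Sum>u\<in>A. w u * k u v * C u v) = (\<Sum>u\<in>A. w u * C u v)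
        - (\<Sum>u\<in>A. of_bool (u = v) * (w u * C u v)) - (\<Sum>u\<in>A. a u v * (w u * C u v))"
      by (simp add: k_def algebra_simps sum_subtractf sum.distrib)
    also have "(\<Sum>u\<in>A. of_bool (u = v) * (w u * C u v)) = w v * nbr A w v"
    proof -
      have "(\<Sum>u\<in>A. of_bool (u = v) * (w u * C u v))
          = (\<Sum>u\<in>A. if u = v then w u * C u v else 0)" by (intro sum.cong) auto
      also have "\<dots> = w v * C v v" using v A by simp
      also have "C v v = nbr A w v" by (simp add: C_def nbr_def a_idem)
      finally show ?thesis .
    qed
    also have "(\<Sum>u\<in>A. w u * C u v) = (\<Sum>x\<in>A. a v x * w x * nbr A w x)"
    proof -
      have "(\<Sum>u\<in>A. w u * C u v) = (\<Sum>u\<in>A. \<Sum>x\<in>A. a v x * w x * (a u x * w u))"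
        by (simp add: C_def sum_distrib_left algebra_simps)
      also have "\<dots> = (\<Sum>x\<in>A. \<Sum>u\<in>A. a v x * w x * (a u x * w u))" by (rule sum.swap)
      also have "\<dots> = (\<Sum>x\<in>A. a v x * w x * nbr A w x)"
        by (simp add: nbr_def sum_distrib_left a_sym[of x for x] cong: sum.cong)
      finally show ?thesis .
    qed
    also have "(\<Sum>u\<in>A. a u v * (w u * C u v))
        = (\<Sum>u\<in>A. \<Sum>x\<in>A. a v u * a v x * a u x * (w u * w x))"
      by (simp add: C_def sum_distrib_left a_sym[of _ v] algebra_simps)
    finally show ?thesis by linarith
  qed
  have "(\<Sum>u\<in>A. w u * y u) + (\<Sum>u\<in>A. \<Sum>v\<in>A. w u * k u v * (y v * f v + q v * C u v))
      \<le> sum w A * alpha A y"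
    unfolding sum.distrib[symmetric] sum_distrib_right by (intro sum_mono pick)
  also have "(\<Sum>u\<in>A. \<Sum>v\<in>A. w u * k u v * (y v * f v + q v * C u v))
      = (\<Sum>v\<in>A. \<Sum>u\<in>A. w u * k u v * (y v * f v + q v * C u v))" by (rule sum.swap)
  also have "\<dots> = (\<Sum>v\<in>A. y v * f v * (\<Sum>u\<in>A. w u * k u v) + q v * (\<Sum>u\<in>A. w u * k u v * C u v))"
    by (simp add: sum_distrib_left sum.distrib[symmetric] algebra_simps)
  finally have "(\<Sum>v\<in>A. w v * y v + (y v * f v * (\<Sum>u\<in>A. w u * k u v)
      + q v * (\<Sum>u\<in>A. w u * k u v * C u v)) - sum w A * (y v * f v))
      \<le> sum w A * alpha A y - sum w A * rate_sum A y w"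
    by (simp add: sum.distrib sum_subtractf sum_distrib_left rate_sum_def f_def)
  also have "(\<Sum>v\<in>A. w v * y v + (y v * f v * (\<Sum>u\<in>A. w u * k u v)
      + q v * (\<Sum>u\<in>A. w u * k u v * C u v)) - sum w A * (y v * f v)) = ?L"
  proof (intro sum.cong refl)
    fix v assume v: "v \<in> A"
    have "y v * (w v - f v * (w v + nbr A w v))
        = q v * ((b + 1) * w v * nbr A w v - (nbr A w v)\<^sup>2)"
      unfolding f_def q_def by (rule ode_at_vertex) (use w v in auto)
    then show "w v * y v + (y v * f v * (\<Sum>u\<in>A. w u * k u v)
      + q v * (\<Sum>u\<in>A. w u * k u v * C u v)) - sum w A * (y v * f v)
      = potential A y w v * w v * (b * w v * nbr A w v - (nbr A w v)\<^sup>2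
      + (\<Sum>x\<in>A. a v x * w x * nbr A w x)
      - (\<Sum>u\<in>A. \<Sum>x\<in>A. a v u * a v x * a u x * (w u * w x)))"
      unfolding count[OF v] paths[OF v] q_def by (simp add: algebra_simps)
  qed
  finally show ?thesis by (simp add: right_diff_distrib)
qed

text \<open>
  An identity for arbitrary \<open>s\<close>: exchanging the roles of \<open>v\<close> and \<open>x\<close> in the path term cancels
  \<open>(nbr A w v) ^ 2\<close> up to the net flow.
\<close>

lemma averaging_in_flow_form:
  "(\<Sum>v\<in>A. s v * w v * (b * w v * nbr A w v - (nbr A w v)\<^sup>2
      + (\<Sum>x\<in>A. a v x * w x * nbr A w x)
      - (\<Sum>u\<in>A. \<Sum>x\<in>A. a v u * a v x * a u x * (w u * w x))))
    = b * (\<Sum>x\<in>A. \<Sum>y\<in>A. a x y * s x * ((w x)\<^sup>2 * w y))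
      - (\<Sum>x\<in>A. \<Sum>y\<in>A. \<Sum>z\<in>A. a x y * a x z * a y z * s x * (w x * w y * w z))
      - (\<Sum>x\<in>A. nbr A w x * flow A s w x)"
proof -
  have "(\<Sum>v\<in>A. s v * w v * (\<Sum>x\<in>A. a v x * w x * nbr A w x))
      = (\<Sum>v\<in>A. \<Sum>x\<in>A. nbr A w x * (a x v * (w x * w v) * s v))"
    by (simp add: sum_distrib_left a_sym[of x for x] algebra_simps cong: sum.cong)
  also have "\<dots> = (\<Sum>x\<in>A. nbr A w x * (\<Sum>v\<in>A. a x v * (w x * w v) * s v))"
    by (subst sum.swap) (simp add: sum_distrib_left)
  also have "\<dots> = (\<Sum>x\<in>A. s x * w x * (nbr A w x)\<^sup>2 - nbr A w x * flow A s w x)"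
    by (intro sum.cong refl)
       (simp add: flow_def nbr_def power2_eq_square sum_distrib_left sum_distrib_right
          sum_subtractf algebra_simps)
  finally have swap: "(\<Sum>v\<in>A. s v * w v * (\<Sum>x\<in>A. a v x * w x * nbr A w x))
      = (\<Sum>x\<in>A. s x * w x * (nbr A w x)\<^sup>2) - (\<Sum>x\<in>A. nbr A w x * flow A s w x)"
    by (simp add: sum_subtractf)
  have edge: "(\<Sum>v\<in>A. s v * w v * (b * w v * nbr A w v))
      = b * (\<Sum>x\<in>A. \<Sum>y\<in>A. a x y * s x * ((w x)\<^sup>2 * w y))"
    by (simp add: nbr_def sum_distrib_left power2_eq_square algebra_simps)
  have tri: "(\<Sum>v\<in>A. s v * w v * (\<Sum>u\<in>A. \<Sum>x\<in>A. a v u * a v x * a u x * (w u * w x)))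
      = (\<Sum>x\<in>A. \<Sum>y\<in>A. \<Sum>z\<in>A. a x y * a x z * a y z * s x * (w x * w y * w z))"
    by (simp add: sum_distrib_left algebra_simps)
  have "(\<Sum>v\<in>A. s v * w v * (b * w v * nbr A w v - (nbr A w v)\<^sup>2
      + (\<Sum>x\<in>A. a v x * w x * nbr A w x)
      - (\<Sum>u\<in>A. \<Sum>x\<in>A. a v u * a v x * a u x * (w u * w x))))
    = (\<Sum>v\<in>A. s v * w v * (b * w v * nbr A w v)) - (\<Sum>v\<in>A. s v * w v * (nbr A w v)\<^sup>2)
      + (\<Sum>v\<in>A. s v * w v * (\<Sum>x\<in>A. a v x * w x * nbr A w x))
      - (\<Sum>v\<in>A. s v * w v * (\<Sum>u\<in>A. \<Sum>x\<in>A. a v u * a v x * a u x * (w u * w x)))"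
    by (simp only: right_diff_distrib distrib_left sum.distrib sum_subtractf)
  then show ?thesis unfolding swap edge tri by simp
qed

text \<open>
  Consider the cut given by the superlevel set \<open>S\<close> of \<open>s\<close> at the height \<open>s x\<close>. All edges leaving
  \<open>S\<close> carry nonnegative flow outwards, and the total flow across the cut is the sum of the net flows out
  of the vertices of \<open>S\<close>; so each single edge across the cut carries at most that total.
\<close>

lemma edge_flow_bound:
  fixes \<eta> :: real
  assumes A: "finite A" and w: "\<And>x. x \<in> A \<Longrightarrow> w x > 0"
    and flow: "\<And>x. x \<in> A \<Longrightarrow> \<bar>flow A s w x\<bar> \<le> \<eta>" and x: "x \<in> A" and y: "y \<in> A"
  shows "a x y * (w x * w y * (s x - s y)) \<le> card A * \<eta>"
proof -
  define p where "p u v = a u v * (w u * w v * (s u - s v))" for u v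
  have \<eta>: "\<eta> \<ge> 0" using flow[OF x] by linarith
  show ?thesis
  proof (cases "s x \<le> s y")
    case True
    then have "p x y \<le> 0" unfolding p_def using w[OF x] w[OF y] a_nonneg
      by (intro mult_nonneg_nonpos) auto
    moreover have "0 \<le> card A * \<eta>" using \<eta> by simp
    ultimately show ?thesis by (simp add: p_def)
  next
    case False
    define S where "S = {v\<in>A. s v \<ge> s x}"
    have S: "S \<subseteq> A" "finite S" "x \<in> S" and y': "y \<in> A - S"
      using A x y False by (auto simp: S_def)
    have nonneg: "p u v \<ge> 0" if "u \<in> S" "v \<in> A - S" for u v
      unfolding p_def using that w[of u] w[of v] a_nonneg
      by (intro mult_nonneg_nonneg) (auto simp: S_def)
    have anti: "p v u = - p u v" for u v by (simp add: p_def a_sym[of v u] algebra_simps)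
    have "(\<Sum>u\<in>S. \<Sum>v\<in>S. p u v) = (\<Sum>u\<in>S. \<Sum>v\<in>S. p v u)" by (rule sum.swap)
    also have "\<dots> = - (\<Sum>u\<in>S. \<Sum>v\<in>S. p u v)"
      unfolding sum_negf[symmetric]
      by (intro sum.cong refl) (rule anti)
    finally have inner: "(\<Sum>u\<in>S. \<Sum>v\<in>S. p u v) = 0" by simp
    have "p x y \<le> (\<Sum>v\<in>A - S. p x v)"
      using A y' S nonneg by (intro member_le_sum) auto
    also have "\<dots> \<le> (\<Sum>u\<in>S. \<Sum>v\<in>A - S. p u v)"
      using S nonneg A by (intro member_le_sum[where f = "\<lambda>u. \<Sum>v\<in>A - S. p u v"] sum_nonneg) auto
    also have "\<dots> = (\<Sum>u\<in>S. \<Sum>v\<in>A. p u v)"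
      using inner by (simp add: sum.subset_diff[OF S(1) A] sum.distrib)
    also have "\<dots> = (\<Sum>u\<in>S. flow A s w u)" by (simp add: flow_def p_def)
    also have "\<dots> \<le> (\<Sum>u\<in>S. \<eta>)" using flow S by (intro sum_mono) force
    also have "\<dots> = card S * \<eta>" by simp
    also have "\<dots> \<le> card A * \<eta>"
      using S A \<eta> by (intro mult_right_mono) (auto intro: card_mono)
    finally show ?thesis by (simp add: p_def)
  qed
qed

text \<open>
  A discrete layer-cake argument. Subtracting the minimum \<open>c\<close> of \<open>s\<close> removes \<open>c\<close> times the unweighted
  inequality on \<open>A\<close>; afterwards \<open>s\<close> vanishes at some vertex, which then contributes nothing to either side
  and can be dropped.
\<close>

lemma triangle_bound_layered:
  assumes "finite A" "A \<subseteq> V" and w: "\<And>x. x \<in> A \<Longrightarrow> w x > 0" and "\<And>x. x \<in> A \<Longrightarrow> s x \<ge> 0"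
  shows "(\<Sum>x\<in>A. \<Sum>y\<in>A. \<Sum>z\<in>A. a x y * a x z * a y z * min (s x) (min (s y) (s z)) * (w x * w y * w z))
    \<le> b * (\<Sum>x\<in>A. \<Sum>y\<in>A. a x y * min (s x) (s y) * ((w x)\<^sup>2 * w y))"
  using assms
proof (induction "card A" arbitrary: A s rule: less_induct)
  case less
  note A = less.prems(1)
  define T where "T B r = (\<Sum>x\<in>B. \<Sum>y\<in>B. \<Sum>z\<in>B.
      a x y * a x z * a y z * min (r x) (min (r y) (r z)) * (w x * w y * w z))" for B and r :: "'a \<Rightarrow> real"
  define D where "D B r = (\<Sum>x\<in>B. \<Sum>y\<in>B. a x y * min (r x) (r y) * ((w x)\<^sup>2 * w y))"
    for B and r :: "'a \<Rightarrow> real"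
  have "T A s \<le> b * D A s"
  proof (cases "A = {}")
    case True
    then show ?thesis by (simp add: T_def D_def)
  next
    case False
    define c where "c = Min (s ` A)"
    have "c \<in> s ` A" unfolding c_def using A False by (intro Min_in) auto
    then obtain u where u: "u \<in> A" "s u = c" by auto
    have c_le: "c \<le> s x" if "x \<in> A" for x unfolding c_def using A that by (intro Min_le) auto
    have c0: "c \<ge> 0" using less.prems(4) u by metis
    define r where "r x = s x - c" for x
    have r0: "r x \<ge> 0" if "x \<in> A" for x using c_le[OF that] by (simp add: r_def)
    have ru: "r u = 0" using u by (simp add: r_def)
    let ?B = "A - {u}"
    have T_s: "T A s = T A r + c * T A (\<lambda>_. 1)"
    proof -
      have "min (s x) (min (s y) (s z)) = min (r x) (min (r y) (r z)) + c" for x y z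
        by (auto simp: r_def min_def)
      then show ?thesis
        by (simp add: T_def sum_distrib_left sum.distrib[symmetric] algebra_simps)
    qed
    have D_s: "D A s = D A r + c * D A (\<lambda>_. 1)"
    proof -
      have "min (s x) (s y) = min (r x) (r y) + c" for x y by (auto simp: r_def min_def)
      then show ?thesis
        by (simp add: D_def sum_distrib_left sum.distrib[symmetric] algebra_simps)
    qed
    have T_r: "T A r = T ?B r"
    proof -
      have z: "min (r x) (min (r y) (r z)) = 0" if "x \<in> A" "y \<in> A" "z \<in> A" "u \<in> {x, y, z}" for x y z
        using that r0[OF that(1)] r0[OF that(2)] r0[OF that(3)] ru by auto
      show ?thesis
        unfolding T_def using A z by (intro sum.mono_neutral_cong_right ballI sum.neutral) auto
    qed
    have D_r: "D A r = D ?B r"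
    proof -
      have z: "min (r x) (r y) = 0" if "x \<in> A" "y \<in> A" "u \<in> {x, y}" for x y
        using that r0[OF that(1)] r0[OF that(2)] ru by auto
      show ?thesis
        unfolding D_def using A z by (intro sum.mono_neutral_cong_right ballI sum.neutral) auto
    qed
    have "card ?B < card A" using A u(1) by (rule card_Diff1_less)
    then have "T ?B r \<le> b * D ?B r"
      unfolding T_def D_def using A r0 less.prems(2,3) by (intro less.hyps) auto
    moreover have "T A (\<lambda>_. 1) \<le> b * D A (\<lambda>_. 1)"
      using triangle_bound[OF less.prems(2), of w] less.prems(3) by (simp add: T_def D_def)
    then have "c * T A (\<lambda>_. 1) \<le> c * (b * D A (\<lambda>_. 1))" using c0 by (rule mult_left_mono)
    ultimately show ?thesis by (simp add: T_s D_s T_r D_r algebra_simps)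
  qed
  then show ?case by (simp only: T_def D_def)
qed

end

section \<open>Nearly critical weights\<close>

context weighted_adjacency
begin

lemma deg_exp:
  "deg A (\<lambda>v. exp (\<sigma> v)) v = (\<Sum>u\<in>A. a v u * exp (\<sigma> u - \<sigma> v))"
  by (simp add: deg_def nbr_def exp_diff sum_divide_distrib)

text \<open>
  A degree is either identically zero or positive for every weight, so the possibly
  nondifferentiable point \<open>0\<close> of the rate function is never approached.
\<close>

lemma deg_zero_or_pos:
  assumes "finite A" "\<And>x. x \<in> A \<Longrightarrow> w x > 0" "w v > 0"
  shows "(\<forall>u\<in>A. a v u = 0) \<or> deg A w v > 0"
proof (cases "\<forall>u\<in>A. a v u = 0")
  case False
  then obtain u where u: "u \<in> A" "a v u \<noteq> 0" by auto
  then have "0 < a v u * w u" using assms(2) a_nonneg[of v u] by (simp add: order_less_le)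
  also have "\<dots> \<le> nbr A w v"
    unfolding nbr_def using u assms a_nonneg
    by (intro member_le_sum) (auto intro!: mult_nonneg_nonneg intro: less_imp_le)
  finally show ?thesis using assms(3) by (simp add: deg_def)
qed simp

lemma rate_sum_continuous:
  assumes "finite A"
  shows "continuous_on UNIV (\<lambda>\<sigma>. rate_sum A y (\<lambda>v. exp (\<sigma> v)))"
  unfolding rate_sum_def
proof (intro continuous_intros)
  fix v assume v: "v \<in> A"
  show "continuous_on UNIV (\<lambda>\<sigma>. indep_fun (b + 1) (deg A (\<lambda>v. exp (\<sigma> v)) v))"
  proof (cases "\<forall>u\<in>A. a v u = 0")
    case True
    then show ?thesis by (simp add: deg_exp)
  next
    case False
    have "continuous_on {0<..} (indep_fun (b + 1))"
      using indep_fun_has_derivative[OF b1_pos]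
      by (intro continuous_at_imp_continuous_on) (auto intro: DERIV_isCont)
    moreover have "continuous_on UNIV (\<lambda>\<sigma>. deg A (\<lambda>v. exp (\<sigma> v)) v)"
      unfolding deg_exp by (intro continuous_intros continuous_on_product_coordinates)
    ultimately show ?thesis
    proof (rule continuous_on_compose2)
      show "(\<lambda>\<sigma>. deg A (\<lambda>v. exp (\<sigma> v)) v) ` UNIV \<subseteq> {0<..}"
        using deg_zero_or_pos[OF assms, of "\<lambda>v. exp (_ v)" v] False by auto
    qed
  qed
qed

lemma rate_sum_has_derivative:
  fixes \<sigma> :: "'a \<Rightarrow> real"
  assumes A: "finite A" and x: "x \<in> A"
  defines "w \<equiv> \<lambda>v. exp (\<sigma> v)"
  shows "((\<lambda>t. rate_sum A y (\<lambda>v. exp ((\<sigma>(x := t)) v))) has_real_derivative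
    flow A (potential A y w) w x) (at (\<sigma> x))"
proof -
  let ?s = "potential A y w"
  define e where "e v = (of_bool (v = x) :: real)" for v
  have coord: "((\<lambda>t. (\<sigma>(x := t)) v) has_real_derivative e v) (at (\<sigma> x))" for v
    by (cases "v = x") (auto simp: e_def)
  have deg': "((\<lambda>t. deg A (\<lambda>v. exp ((\<sigma>(x := t)) v)) v) has_real_derivative
      (\<Sum>u\<in>A. a v u * (w u / w v * (e u - e v)))) (at (\<sigma> x))" for v
    unfolding deg_exp
  proof (rule DERIV_sum, rule DERIV_cmult)
    fix u
    show "((\<lambda>t. exp ((\<sigma>(x := t)) u - (\<sigma>(x := t)) v)) has_real_derivative
        w u / w v * (e u - e v)) (at (\<sigma> x))"
      using DERIV_exp[THEN DERIV_chain2, OF DERIV_diff[OF coord[of u] coord[of v]]]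
      by (simp add: w_def exp_diff)
  qed
  have term': "((\<lambda>t. y v * indep_fun (b + 1) (deg A (\<lambda>v. exp ((\<sigma>(x := t)) v)) v))
      has_real_derivative (\<Sum>u\<in>A. ?s v * (a v u * (w u * w v * (e v - e u))))) (at (\<sigma> x))" for v
  proof (cases "\<forall>u\<in>A. a v u = 0")
    case True
    then show ?thesis by (simp add: deg_exp)
  next
    case False
    have wp: "w u > 0" for u by (simp add: w_def)
    have "deg A w v > 0" using deg_zero_or_pos[OF A, of w v] False wp by simp
    from indep_fun_has_derivative[OF b1_pos this]
    have "(indep_fun (b + 1) has_real_derivative - indep_slope (b + 1) (deg A w v))
        (at (deg A (\<lambda>v. exp ((\<sigma>(x := \<sigma> x)) v)) v))" by (simp add: w_def)
    from DERIV_cmult[OF DERIV_chain2[OF this deg'[of v]], of "y v"]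
    have "((\<lambda>t. y v * indep_fun (b + 1) (deg A (\<lambda>v. exp ((\<sigma>(x := t)) v)) v)) has_real_derivative
       y v * (- indep_slope (b + 1) (deg A w v) * (\<Sum>u\<in>A. a v u * (w u / w v * (e u - e v)))))
       (at (\<sigma> x))" .
    also have "y v * (- indep_slope (b + 1) (deg A w v) * (\<Sum>u\<in>A. a v u * (w u / w v * (e u - e v))))
        = (\<Sum>u\<in>A. ?s v * (a v u * (w u * w v * (e v - e u))))"
      unfolding sum_distrib_left
    proof (intro sum.cong refl)
      fix u
      show "y v * (- indep_slope (b + 1) (deg A w v) * (a v u * (w u / w v * (e u - e v))))
          = ?s v * (a v u * (w u * w v * (e v - e u)))"
        using wp[of v] by (simp add: potential_def power2_eq_square field_simps)
    qed
    finally show ?thesis .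
  qed
  have "((\<lambda>t. rate_sum A y (\<lambda>v. exp ((\<sigma>(x := t)) v))) has_real_derivative
      (\<Sum>v\<in>A. \<Sum>u\<in>A. ?s v * (a v u * (w u * w v * (e v - e u))))) (at (\<sigma> x))"
    unfolding rate_sum_def by (intro DERIV_sum term')
  also have "(\<Sum>v\<in>A. \<Sum>u\<in>A. ?s v * (a v u * (w u * w v * (e v - e u)))) = flow A ?s w x"
  proof -
    have pick: "(\<Sum>v\<in>A. e v * g v) = g x" for g :: "'a \<Rightarrow> real"
    proof -
      have "(\<Sum>v\<in>A. e v * g v) = (\<Sum>v\<in>A. if v = x then g v else 0)"
        by (intro sum.cong) (auto simp: e_def)
      then show ?thesis using A x by simp
    qed
    have "(\<Sum>v\<in>A. \<Sum>u\<in>A. ?s v * (a v u * (w u * w v * (e v - e u))))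
        = (\<Sum>v\<in>A. e v * (\<Sum>u\<in>A. ?s v * (a v u * (w u * w v))))
          - (\<Sum>v\<in>A. \<Sum>u\<in>A. e u * (?s v * (a v u * (w u * w v))))"
      by (simp add: sum_subtractf[symmetric] sum_distrib_left algebra_simps)
    also have "\<dots> = (\<Sum>u\<in>A. ?s x * (a x u * (w u * w x))) - (\<Sum>v\<in>A. ?s v * (a v x * (w x * w v)))"
      by (simp only: pick)
    also have "\<dots> = flow A ?s w x"
      by (simp add: flow_def sum_subtractf[symmetric] a_sym[of _ x] algebra_simps)
    finally show ?thesis .
  qed
  finally show ?thesis .
qed

lemma rate_sum_le:
  assumes "\<And>x. x \<in> A \<Longrightarrow> w x > 0" "\<And>x. x \<in> A \<Longrightarrow> y x \<ge> 0"
  shows "rate_sum A y w \<le> sum y A"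
  unfolding rate_sum_def using assms indep_fun_le_1[OF b1_pos deg_nonneg]
  by (intro sum_mono mult_left_le) auto

lemma rate_sum_nonneg:
  assumes "\<And>x. x \<in> A \<Longrightarrow> w x > 0" "\<And>x. x \<in> A \<Longrightarrow> y x \<ge> 0"
  shows "rate_sum A y w \<ge> 0"
  unfolding rate_sum_def using assms indep_fun_nonneg[OF b1_pos deg_nonneg]
  by (intro sum_nonneg mult_nonneg_nonneg) auto

lemma rate_sum_cong:
  assumes "\<And>x. x \<in> A \<Longrightarrow> w x = w' x"
  shows "rate_sum A y w = rate_sum A y w'"
  unfolding rate_sum_def deg_def nbr_def using assms by (auto intro!: sum.cong)

text \<open>
  In logarithmic coordinates \<open>\<sigma> = ln w\<close>, the function \<open>H \<sigma>\<close>, which is \<open>rate_sum\<close> minus the penalty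
  \<open>\<epsilon> * (\<Sum>v\<in>A. (\<sigma> v) ^ 2)\<close>, has its maximum over a large box in the interior, because \<open>rate_sum\<close> is
  bounded by \<open>sum y A\<close>. At the maximum the flow out of \<open>x\<close> equals \<open>2 * \<epsilon> * \<sigma> x\<close>. The penalty
  \<open>\<epsilon> * (\<sigma> x) ^ 2\<close> stays bounded as \<open>\<epsilon>\<close> tends to \<open>0\<close>, so this flow is of order \<open>sqrt \<epsilon>\<close>.
\<close>

lemma near_critical_weight:
  fixes \<eta> :: real
  assumes A: "finite A" and w\<^sub>i: "\<And>x. x \<in> A \<Longrightarrow> w\<^sub>i x > 0" and y: "\<And>x. x \<in> A \<Longrightarrow> y x \<ge> 0"
    and \<eta>: "\<eta> > 0"
  obtains w where "\<And>x. x \<in> A \<Longrightarrow> w x > 0" "rate_sum A y w\<^sub>i - \<eta> \<le> rate_sum A y w"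
    "\<And>x. x \<in> A \<Longrightarrow> \<bar>flow A (potential A y w) w x\<bar> \<le> \<eta>"
proof -
  define ew where "ew \<sigma> v = exp (\<sigma> v :: real)" for \<sigma> and v :: 'a
  have ew_pos: "ew \<sigma> v > 0" for \<sigma> v by (simp add: ew_def)
  define \<sigma>0 where "\<sigma>0 v = (if v \<in> A then ln (w\<^sub>i v) else 0)" for v
  define N0 where "N0 = (\<Sum>v\<in>A. (\<sigma>0 v)\<^sup>2)"
  define Y where "Y = sum y A"
  \<comment> \<open>chosen for \<open>\<epsilon>N0\<close> (small loss of value) and \<open>\<epsilon>\<eta>\<close> (small flow) below\<close>
  define \<epsilon> where "\<epsilon> = min 1 (min (\<eta> / (N0 + 1)) (\<eta>\<^sup>2 / (4 * (Y + N0 + 1))))"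
  have N0: "N0 \<ge> 0" by (simp add: N0_def sum_nonneg)
  have Y: "Y \<ge> 0" using y by (simp add: Y_def sum_nonneg)
  have \<epsilon>: "0 < \<epsilon>" "\<epsilon> \<le> 1" using \<eta> N0 Y by (auto simp: \<epsilon>_def)
  have "\<epsilon> * (N0 + 1) \<le> \<eta>" using N0 by (simp add: \<epsilon>_def pos_le_divide_eq[symmetric])
  then have \<epsilon>N0: "\<epsilon> * N0 \<le> \<eta>" using \<epsilon> by (simp add: distrib_left)
  have "\<epsilon> * (4 * (Y + N0 + 1)) \<le> \<eta>\<^sup>2" using N0 Y by (simp add: \<epsilon>_def pos_le_divide_eq[symmetric])
  moreover have "\<epsilon> * N0 \<le> N0" using N0 \<epsilon> by (simp add: mult_left_le_one_le)
  then have "4 * \<epsilon> * (Y + \<epsilon> * N0) \<le> 4 * \<epsilon> * (Y + N0 + 1)" using \<epsilon> by (intro mult_left_mono) auto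
  ultimately have \<epsilon>\<eta>: "4 * \<epsilon> * (Y + \<epsilon> * N0) \<le> \<eta>\<^sup>2" by (simp add: algebra_simps)
  define H where "H \<sigma> = rate_sum A y (ew \<sigma>) - \<epsilon> * (\<Sum>v\<in>A. (\<sigma> v)\<^sup>2)" for \<sigma>
  \<comment> \<open>no coordinate of a maximiser can exceed \<open>sqrt K\<close>, and \<open>sqrt K < R\<close>\<close>
  define K where "K = (Y + \<epsilon> * N0) / \<epsilon>"
  have K: "K \<ge> N0" "\<epsilon> * K = Y + \<epsilon> * N0" using \<epsilon> Y by (auto simp: K_def field_simps)
  define R where "R = K + 1"
  have R: "R \<ge> 1" using K N0 by (simp add: R_def)
  have sq_lt: "\<bar>z\<bar> < R" if "z\<^sup>2 \<le> K" for z
  proof -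
    have "K < 1 * R" by (simp add: R_def)
    also have "\<dots> \<le> R * R" using R by (intro mult_right_mono) auto
    finally have "K < R * R" .
    then have "\<bar>z\<bar>\<^sup>2 < R\<^sup>2" using that by (simp add: power2_eq_square)
    then show ?thesis by (rule power_less_imp_less_base) (use R in simp)
  qed
  let ?B = "Pi UNIV (\<lambda>_::'a. {- R..R})"
  have "continuous_on UNIV H"
    unfolding H_def ew_def
    by (intro continuous_intros rate_sum_continuous A continuous_on_product_coordinates)
  then have contH: "continuous_on ?B H" by (rule continuous_on_subset) simp
  have \<sigma>0_in: "\<sigma>0 \<in> ?B"
  proof
    fix v
    have "\<bar>\<sigma>0 v\<bar> < R"
    proof (cases "v \<in> A")
      case True
      then have "(\<sigma>0 v)\<^sup>2 \<le> N0" unfolding N0_def using A by (intro member_le_sum) auto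
      then show ?thesis using K by (intro sq_lt) simp
    qed (use R in \<open>simp add: \<sigma>0_def\<close>)
    then show "\<sigma>0 v \<in> {- R..R}" by auto
  qed
  obtain \<sigma> where \<sigma>: "\<sigma> \<in> ?B" and max: "\<And>\<tau>. \<tau> \<in> ?B \<Longrightarrow> H \<tau> \<le> H \<sigma>"
    using continuous_attains_sup[OF compact_real_box_functions _ contH] \<sigma>0_in by blast
  define N where "N = (\<Sum>v\<in>A. (\<sigma> v)\<^sup>2)"
  have N: "N \<ge> 0" by (simp add: N_def sum_nonneg)
  have wi_eq: "rate_sum A y (ew \<sigma>0) = rate_sum A y w\<^sub>i"
    using w\<^sub>i by (intro rate_sum_cong) (simp add: ew_def \<sigma>0_def)
  have key: "rate_sum A y w\<^sub>i - \<epsilon> * N0 \<le> rate_sum A y (ew \<sigma>) - \<epsilon> * N"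
    using max[OF \<sigma>0_in] by (simp add: H_def wi_eq N0_def N_def)
  have "rate_sum A y w\<^sub>i \<ge> 0" "rate_sum A y (ew \<sigma>) \<le> Y"
    unfolding Y_def by (intro rate_sum_nonneg rate_sum_le w\<^sub>i y ew_pos; assumption)+
  then have NK: "\<epsilon> * N \<le> \<epsilon> * K" using key K by linarith
  have coord: "\<epsilon> * (\<sigma> x)\<^sup>2 \<le> \<epsilon> * K" if "x \<in> A" for x
  proof -
    have "(\<sigma> x)\<^sup>2 \<le> N" unfolding N_def using A that by (intro member_le_sum) auto
    then have "\<epsilon> * (\<sigma> x)\<^sup>2 \<le> \<epsilon> * N" using \<epsilon> by (intro mult_left_mono) auto
    then show ?thesis using NK by linarith
  qed
  show thesis
  proof (rule that[of "ew \<sigma>"])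
    show "rate_sum A y w\<^sub>i - \<eta> \<le> rate_sum A y (ew \<sigma>)"
      using key \<epsilon>N0 N \<epsilon> mult_nonneg_nonneg[of \<epsilon> N] by linarith
  next
    fix x assume x: "x \<in> A"
    let ?\<gamma> = "flow A (potential A y (ew \<sigma>)) (ew \<sigma>) x"
    have inside: "\<bar>\<sigma> x\<bar> < R" using coord[OF x] \<epsilon> by (intro sq_lt) simp
    have split: "(\<Sum>v\<in>A. ((\<sigma>(x := t)) v)\<^sup>2) = t\<^sup>2 + (\<Sum>v\<in>A - {x}. (\<sigma> v)\<^sup>2)" for t
      using A x by (simp add: sum.remove[of A x])
    have "((\<lambda>t. H (\<sigma>(x := t))) has_real_derivative (?\<gamma> - \<epsilon> * (2 * \<sigma> x))) (at (\<sigma> x))"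
      unfolding H_def split ew_def
      by (intro DERIV_diff DERIV_cmult rate_sum_has_derivative A x)
         (auto intro!: derivative_eq_intros)
    moreover have "\<forall>t. \<bar>\<sigma> x - t\<bar> < R - \<bar>\<sigma> x\<bar> \<longrightarrow> H (\<sigma>(x := t)) \<le> H (\<sigma>(x := \<sigma> x))"
    proof (intro allI impI)
      fix t assume "\<bar>\<sigma> x - t\<bar> < R - \<bar>\<sigma> x\<bar>"
      then have "t \<in> {- R..R}" by auto
      then have "\<sigma>(x := t) \<in> ?B" using \<sigma> by (auto simp: Pi_iff)
      then show "H (\<sigma>(x := t)) \<le> H (\<sigma>(x := \<sigma> x))" using max by simp
    qed
    ultimately have "?\<gamma> - \<epsilon> * (2 * \<sigma> x) = 0"
      using inside by (intro DERIV_local_max[where d = "R - \<bar>\<sigma> x\<bar>"]) auto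
    then have "?\<gamma>\<^sup>2 = 4 * \<epsilon> * (\<epsilon> * (\<sigma> x)\<^sup>2)" by (simp add: power2_eq_square)
    also have "\<dots> \<le> 4 * \<epsilon> * (\<epsilon> * K)" using coord[OF x] \<epsilon> by (intro mult_left_mono) auto
    also have "\<dots> \<le> \<eta>\<^sup>2" using \<epsilon>\<eta> K by simp
    finally show "\<bar>?\<gamma>\<bar> \<le> \<eta>" using \<eta> by (simp add: abs_le_square_iff[symmetric])
  qed (rule ew_pos)
qed

end

section \<open>Heavy independent sets\<close>

context weighted_adjacency
begin

text \<open>
  If no vertex has a net flow above \<open>\<eta>\<close>, then replacing \<open>s x\<close> by the minimum of \<open>s\<close> over a triangle
  costs at most the flow along an edge of the triangle times the weight of the third vertex. The
  layered triangle bound applies to the minima. All errors are proportional to the total weight, by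
  which the averaged inequality is divided.
\<close>

lemma near_critical_deficit:
  fixes \<eta> :: real
  assumes A: "finite A" "A \<subseteq> V" "A \<noteq> {}"
    and w: "\<And>x. x \<in> A \<Longrightarrow> w x > 0" and y: "\<And>x. x \<in> A \<Longrightarrow> y x \<ge> 0"
    and flow: "\<And>x. x \<in> A \<Longrightarrow> \<bar>flow A (potential A y w) w x\<bar> \<le> \<eta>"
    and IH: "\<And>u. u \<in> A \<Longrightarrow> rate_sum (survivors A u) y w \<le> alpha (survivors A u) y"
  shows "rate_sum A y w - (card A + 2 * (card A)^3) * \<eta> \<le> alpha A y"
proof -
  define n where "n = real (card A)"
  define W where "W = sum w A"
  let ?s = "potential A y w"
  have W: "W > 0" unfolding W_def using A w by (intro sum_pos) auto
  have \<eta>: "\<eta> \<ge> 0" using flow A(3) by fastforce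
  have s: "?s x \<ge> 0" if "x \<in> A" for x using that w y by (intro potential_nonneg) auto
  have edge: "a x z * (w x * w z * (?s x - ?s z)) \<le> n * \<eta>" if "x \<in> A" "z \<in> A" for x z
    unfolding n_def by (rule edge_flow_bound[OF A(1) w flow that])
  have n\<eta>: "n * \<eta> \<ge> 0" using \<eta> by (simp add: n_def)
  define T where "T = (\<Sum>x\<in>A. \<Sum>p\<in>A. \<Sum>z\<in>A. a x p * a x z * a p z * ?s x * (w x * w p * w z))"
  define D where "D = (\<Sum>x\<in>A. \<Sum>p\<in>A. a x p * ?s x * ((w x)\<^sup>2 * w p))"
  define T' where "T' = (\<Sum>x\<in>A. \<Sum>p\<in>A. \<Sum>z\<in>A.
    a x p * a x z * a p z * min (?s x) (min (?s p) (?s z)) * (w x * w p * w z))"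
  define D' where "D' = (\<Sum>x\<in>A. \<Sum>p\<in>A. a x p * min (?s x) (?s p) * ((w x)\<^sup>2 * w p))"
  have "T' \<le> b * D'"
    unfolding T'_def D'_def by (rule triangle_bound_layered[OF A(1,2) w s])
  moreover have "D' \<le> D"
    unfolding D'_def D_def using w a_nonneg
    by (intro sum_mono mult_right_mono mult_left_mono mult_nonneg_nonneg) (auto intro: less_imp_le)
  then have "b * D' \<le> b * D" using b_nonneg by (rule mult_left_mono)
  moreover have "T \<le> T' + 2 * n ^ 3 * \<eta> * W"
  proof -
    have "a x p * a x z * a p z * ?s x * (w x * w p * w z)
        \<le> a x p * a x z * a p z * min (?s x) (min (?s p) (?s z)) * (w x * w p * w z)
          + n * \<eta> * (w p + w z)"
      if x: "x \<in> A" and p: "p \<in> A" and z: "z \<in> A" for x p z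
    proof -
      note pos = w[OF x] w[OF p] w[OF z]
      \<comment> \<open>flow on the edge from \<open>x\<close> to \<open>i\<close>, times the weight of the third vertex \<open>j\<close>\<close>
      have third: "a x i * (w x * w i * (?s x - ?s i)) * (a x j * a i j * w j) \<le> n * \<eta> * w j"
        if i: "i \<in> A" and j: "j \<in> A" for i j
      proof -
        have le: "a x j * a i j * w j \<le> w j"
          using w[OF j] a_nonneg a_le_1
          by (intro mult_left_le_one_le mult_le_one mult_nonneg_nonneg) auto
        have nn: "0 \<le> a x j * a i j * w j"
          using w[OF j] a_nonneg by (intro mult_nonneg_nonneg) auto
        have "a x i * (w x * w i * (?s x - ?s i)) * (a x j * a i j * w j) \<le> n * \<eta> * (a x j * a i j * w j)"
          using edge[OF x i] nn by (rule mult_right_mono)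
        also have "\<dots> \<le> n * \<eta> * w j" using le n\<eta> by (rule mult_left_mono)
        finally show ?thesis .
      qed
      have nn: "0 \<le> n * \<eta> * w p" "0 \<le> n * \<eta> * w z" using pos n\<eta> by auto
      consider "min (?s x) (min (?s p) (?s z)) = ?s x" | "min (?s x) (min (?s p) (?s z)) = ?s p"
        | "min (?s x) (min (?s p) (?s z)) = ?s z" by linarith
      then show ?thesis
      proof cases
        case 1
        then show ?thesis using nn by (simp add: distrib_left)
      next
        case 2
        then show ?thesis using third[OF p z] nn by (simp add: algebra_simps)
      next
        case 3
        then show ?thesis using third[OF z p] nn by (simp add: algebra_simps a_sym[of z p])
      qed
    qed
    then have "T \<le> (\<Sum>x\<in>A. \<Sum>p\<in>A. \<Sum>z\<in>A.
        a x p * a x z * a p z * min (?s x) (min (?s p) (?s z)) * (w x * w p * w z)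
          + n * \<eta> * (w p + w z))"
      unfolding T_def by (intro sum_mono) auto
    also have "\<dots> = T' + (\<Sum>x\<in>A. \<Sum>p\<in>A. \<Sum>z\<in>A. n * \<eta> * (w p + w z))"
      by (simp only: sum.distrib T'_def)
    also have "(\<Sum>x\<in>A. \<Sum>p\<in>A. \<Sum>z\<in>A. n * \<eta> * (w p + w z)) = 2 * n ^ 3 * \<eta> * W"
      by (simp add: sum.distrib sum_distrib_left[symmetric] W_def[symmetric] n_def[symmetric]
          distrib_left power3_eq_cube algebra_simps)
    finally show ?thesis .
  qed
  moreover have "(\<Sum>x\<in>A. nbr A w x * flow A ?s w x) \<le> W * n * \<eta>"
  proof -
    have "(\<Sum>x\<in>A. nbr A w x * flow A ?s w x) \<le> (\<Sum>x\<in>A. W * \<eta>)"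
    proof (rule sum_mono)
      fix x assume x: "x \<in> A"
      have "nbr A w x * flow A ?s w x \<le> nbr A w x * \<eta>"
        using flow[OF x] nbr_nonneg[OF w] by (intro mult_left_mono) auto
      also have "\<dots> \<le> W * \<eta>" unfolding W_def using \<eta> by (intro mult_right_mono nbr_le A w)
      finally show "nbr A w x * flow A ?s w x \<le> W * \<eta>" .
    qed
    then show ?thesis by (simp add: n_def algebra_simps)
  qed
  moreover have "b * D - T - (\<Sum>x\<in>A. nbr A w x * flow A ?s w x) \<le> W * (alpha A y - rate_sum A y w)"
    unfolding W_def T_def D_def averaging_in_flow_form[symmetric]
    by (rule averaged_survivors[OF A(1) w y IH])
  ultimately have "- (W * n * \<eta>) - 2 * n ^ 3 * \<eta> * W \<le> W * (alpha A y - rate_sum A y w)"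
    by linarith
  then have "W * (- (n + 2 * n ^ 3) * \<eta>) \<le> W * (alpha A y - rate_sum A y w)"
    by (simp add: algebra_simps)
  then have "- (n + 2 * n ^ 3) * \<eta> \<le> alpha A y - rate_sum A y w"
    using W by (simp only: mult_le_cancel_left_pos)
  then show ?thesis by (simp add: n_def algebra_simps)
qed

text \<open>
  The weight \<open>w\<close> is generalised in the induction, since the induction hypothesis is needed at the
  nearly critical weight \<open>w'\<close> and not at the given one.
\<close>

lemma rate_sum_le_alpha:
  assumes "A \<subseteq> V" "\<And>x. x \<in> A \<Longrightarrow> w x > 0" "\<And>x. x \<in> A \<Longrightarrow> y x \<ge> 0"
  shows "rate_sum A y w \<le> alpha A y"
  using assms
proof (induction "card A" arbitrary: A w rule: less_induct)
  case less
  have A: "finite A" using less.prems(1) finite_V finite_subset by blast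
  show ?case
  proof (cases "A = {}")
    case True
    have "sum y {} \<le> alpha A y" using A by (intro alpha_ge empty_stable)
    then show ?thesis using True by (simp add: rate_sum_def)
  next
    case False
    define c where "c = real (card A + 2 * (card A)^3) + 1"
    have c: "c > 0" unfolding c_def by (intro add_nonneg_pos) auto
    show ?thesis
    proof (rule field_le_epsilon)
      fix e :: real assume "e > 0"
      then have \<eta>: "e / c > 0" using c by simp
      obtain w' where w': "\<And>x. x \<in> A \<Longrightarrow> w' x > 0"
        and near: "rate_sum A y w - e / c \<le> rate_sum A y w'"
        and flow: "\<And>x. x \<in> A \<Longrightarrow> \<bar>flow A (potential A y w') w' x\<bar> \<le> e / c"
        by (rule near_critical_weight[OF A, where w\<^sub>i = w and y = y and \<eta> = "e / c"])
           (use less.prems \<eta> in auto)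
      have "rate_sum A y w' - (card A + 2 * (card A)^3) * (e / c) \<le> alpha A y"
      proof (rule near_critical_deficit[where w = w', OF A less.prems(1) False])
        fix u assume u: "u \<in> A"
        have "survivors A u \<subseteq> A - {u}" by (auto simp: survivors_def)
        then have "card (survivors A u) < card A"
          using A u by (meson card_Diff1_less card_mono finite_Diff le_less_trans)
        moreover have "survivors A u \<subseteq> A" by (auto simp: survivors_def)
        ultimately show "rate_sum (survivors A u) y w' \<le> alpha (survivors A u) y"
          using less.prems w' by (intro less.hyps) auto
      qed (use less.prems w' flow in auto)
      with near have "rate_sum A y w \<le> alpha A y + (real (card A + 2 * (card A)^3) * (e / c) + 1 * (e / c))"
        by linarith
      also have "\<dots> = alpha A y + c * (e / c)" unfolding c_def distrib_right ..
      finally have "rate_sum A y w \<le> alpha A y + c * (e / c)" .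
      then show "rate_sum A y w \<le> alpha A y + e" using c by simp
    qed
  qed
qed

end

section \<open>Triangle density and ordered sums\<close>

definition adj :: "'a set set \<Rightarrow> 'a \<Rightarrow> 'a \<Rightarrow> real" where
  "adj E x y = of_bool ({x, y} \<in> E)"

lemma edge_distinct: "simple_graph V E \<Longrightarrow> {x, y} \<in> E \<Longrightarrow> x \<noteq> y"
  unfolding simple_graph_def by force

lemma edge_weight_ordered:
  assumes G: "simple_graph V E" and B: "B \<subseteq> V"
  shows "(\<Sum>x\<in>B. \<Sum>y\<in>B. adj E x y * ((w x)\<^sup>2 * w y)) = edge_weight (induced_edges E B) w"
proof -
  have fin: "finite B" using G B by (auto simp: simple_graph_def intro: finite_subset)
  define P where "P = {p \<in> B \<times> B. {fst p, snd p} \<in> E}"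
  define F where "F = induced_edges E B"
  have finP: "finite P" using fin by (simp add: P_def)
  have finF: "finite F" by (rule finite_subset[of _ "Pow B"]) (use fin in \<open>auto simp: F_def induced_edges_def\<close>)
  have "(\<Sum>x\<in>B. \<Sum>y\<in>B. adj E x y * ((w x)\<^sup>2 * w y)) = (\<Sum>p\<in>P. (w (fst p))\<^sup>2 * w (snd p))"
    unfolding sum.cartesian_product
    using fin by (intro sum.mono_neutral_cong_right) (auto simp: P_def adj_def)
  also have "\<dots> = (\<Sum>e\<in>F. \<Sum>p\<in>{p\<in>P. {fst p, snd p} = e}. (w (fst p))\<^sup>2 * w (snd p))"
    by (rule sum.group[symmetric, OF finP finF]) (auto simp: P_def F_def induced_edges_def)
  also have "\<dots> = (\<Sum>e\<in>F. (\<Prod>x\<in>e. w x) * (\<Sum>x\<in>e. w x))"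
  proof (rule sum.cong[OF refl])
    fix e assume e: "e \<in> F"
    then have "card e = 2" using G by (auto simp: F_def induced_edges_def simple_graph_def)
    then obtain p q where pq: "e = {p, q}" "p \<noteq> q" by (auto simp: card_2_iff)
    then have "{r\<in>P. {fst r, snd r} = e} = {(p, q), (q, p)}"
      using e by (auto simp: P_def F_def induced_edges_def doubleton_eq_iff insert_commute)
    then show "(\<Sum>p\<in>{p\<in>P. {fst p, snd p} = e}. (w (fst p))\<^sup>2 * w (snd p))
        = (\<Prod>x\<in>e. w x) * (\<Sum>x\<in>e. w x)"
      using pq by (simp add: power2_eq_square algebra_simps)
  qed
  finally show ?thesis by (simp add: edge_weight_def F_def)
qed

lemma triangle_weight_ordered:
  assumes G: "simple_graph V E" and B: "B \<subseteq> V"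
  shows "(\<Sum>x\<in>B. \<Sum>y\<in>B. \<Sum>z\<in>B. adj E x y * adj E x z * adj E y z * (w x * w y * w z))
    = 6 * triangle_weight B (induced_edges E B) w"
proof -
  have fin: "finite B" using G B by (auto simp: simple_graph_def intro: finite_subset)
  define S where "S = {(x, y, z). x \<in> B \<and> y \<in> B \<and> z \<in> B \<and> {x, y} \<in> E \<and> {x, z} \<in> E \<and> {y, z} \<in> E}"
  define T where "T = triangles B (induced_edges E B)"
  define vs where "vs = (\<lambda>(x, y, z). {x, y, z :: 'a})"
  define h where "h = (\<lambda>(x, y, z). w x * w y * w z)"
  have finS: "finite S"
    by (rule finite_subset[of _ "B \<times> B \<times> B"]) (use fin in \<open>auto simp: S_def\<close>)
  have finT: "finite T"
    by (rule finite_subset[of _ "Pow B"]) (use fin in \<open>auto simp: T_def triangles_def\<close>)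
  have "(\<Sum>x\<in>B. \<Sum>y\<in>B. \<Sum>z\<in>B. adj E x y * adj E x z * adj E y z * (w x * w y * w z)) = sum h S"
    unfolding sum.cartesian_product
    using fin by (intro sum.mono_neutral_cong_right) (auto simp: S_def adj_def h_def)
  also have "\<dots> = (\<Sum>t\<in>T. sum h {p\<in>S. vs p = t})"
  proof (rule sum.group[symmetric, OF finS finT])
    show "vs ` S \<subseteq> T"
    proof
      fix t assume "t \<in> vs ` S"
      then obtain x y z where t: "t = {x, y, z}" and "(x, y, z) \<in> S" by (auto simp: vs_def)
      then have *: "x \<in> B" "y \<in> B" "z \<in> B" "{x, y} \<in> E" "{x, z} \<in> E" "{y, z} \<in> E"
        by (auto simp: S_def)
      moreover have "x \<noteq> y" "x \<noteq> z" "y \<noteq> z" using * edge_distinct[OF G] by metis+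
      ultimately show "t \<in> T"
        unfolding T_def triangles_def t induced_edges_def by blast
    qed
  qed
  also have "\<dots> = (\<Sum>t\<in>T. 6 * (\<Prod>x\<in>t. w x))"
  proof (rule sum.cong[OF refl])
    fix t assume "t \<in> T"
    then obtain p q r where t: "t = {p, q, r}" and d: "p \<noteq> q" "q \<noteq> r" "p \<noteq> r"
      and m: "p \<in> B" "q \<in> B" "r \<in> B" and e: "{p, q} \<in> E" "{q, r} \<in> E" "{p, r} \<in> E"
      unfolding T_def triangles_def induced_edges_def by blast
    have "{k\<in>S. vs k = t} = {(p, q, r), (p, r, q), (q, p, r), (q, r, p), (r, p, q), (r, q, p)}"
      (is "?L = ?R")
    proof
      show "?L \<subseteq> ?R"
      proof
        fix k assume "k \<in> ?L"
        then obtain x y z where k: "k = (x, y, z)" "(x, y, z) \<in> S" and v: "{x, y, z} = {p, q, r}"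
          by (cases k) (auto simp: vs_def t)
        have "x \<noteq> y" "x \<noteq> z" "y \<noteq> z" using k(2) edge_distinct[OF G] unfolding S_def by auto
        moreover have "x \<in> {p, q, r}" "y \<in> {p, q, r}" "z \<in> {p, q, r}" using v by auto
        ultimately show "k \<in> ?R" unfolding k(1) by auto
      qed
      show "?R \<subseteq> ?L" using m e by (auto simp: S_def vs_def t insert_commute)
    qed
    then show "sum h {k\<in>S. vs k = t} = 6 * (\<Prod>x\<in>t. w x)"
      using d by (simp add: t h_def)
  qed
  finally show ?thesis by (simp add: triangle_weight_def T_def sum_distrib_left)
qed

lemma triangle_ratio_le_density:
  assumes "simple_graph V E" "B \<subseteq> V" "w \<in> B \<rightarrow> {0<..}"
  shows "ereal (triangle_ratio B (induced_edges E B) w) \<le> triangle_density V E"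
proof -
  have "ereal (triangle_ratio B (induced_edges E B) w)
      \<le> (SUP w\<in>B \<rightarrow> {0<..}. ereal (triangle_ratio B (induced_edges E B) w))"
    using assms(3) by (rule SUP_upper)
  also have "\<dots> \<le> triangle_density V E"
    unfolding triangle_density_def using assms(1,2)
    by (intro Max_ge finite_imageI) (auto simp: simple_graph_def)
  finally show ?thesis .
qed

text \<open>
  If the edge weight vanishes, the ratio is zero by convention and carries no information; but then the
  induced graph has no edges, and both sides are zero.
\<close>

lemma triangle_bound_of_density:
  assumes G: "simple_graph V E" and density: "triangle_density V E \<le> ereal b"
    and B: "B \<subseteq> V" and w: "\<And>x. x \<in> B \<Longrightarrow> w x > 0"
  shows "(\<Sum>x\<in>B. \<Sum>y\<in>B. \<Sum>z\<in>B. adj E x y * adj E x z * adj E y z * (w x * w y * w z))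
    \<le> b * (\<Sum>x\<in>B. \<Sum>y\<in>B. adj E x y * ((w x)\<^sup>2 * w y))"
proof -
  define F where "F = induced_edges E B"
  have fin: "finite B" using G B by (auto simp: simple_graph_def intro: finite_subset)
  have finF: "finite F" by (rule finite_subset[of _ "Pow B"]) (use fin in \<open>auto simp: F_def induced_edges_def\<close>)
  have "triangle_ratio B F w \<le> b"
    using order_trans[OF triangle_ratio_le_density[OF G B, of w] density] w by (simp add: F_def)
  then have "6 * triangle_weight B F w \<le> b * edge_weight F w"
  proof (cases "edge_weight F w > 0")
    case True
    then show ?thesis using \<open>triangle_ratio B F w \<le> b\<close>
      by (simp add: triangle_ratio_def pos_divide_le_eq)
  next
    case False
    have "F = {}"
    proof (rule ccontr)
      assume "F \<noteq> {}"
      have "(\<Prod>x\<in>e. w x) * (\<Sum>x\<in>e. w x) > 0" if "e \<in> F" for e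
      proof -
        have e: "e \<subseteq> B" "e \<noteq> {}"
          using that G by (auto simp: F_def induced_edges_def simple_graph_def)
        then have "finite e" using fin finite_subset by blast
        then show ?thesis using e w by (intro mult_pos_pos prod_pos sum_pos) auto
      qed
      then have "edge_weight F w > 0"
        unfolding edge_weight_def using finF \<open>F \<noteq> {}\<close> by (intro sum_pos) auto
      then show False using False by simp
    qed
    then show ?thesis by (simp add: triangle_weight_def triangles_def edge_weight_def)
  qed
  then show ?thesis
    unfolding triangle_weight_ordered[OF G B] edge_weight_ordered[OF G B] F_def .
qed

section \<open>Existence of the distribution\<close>

theorem theorem2:
  fixes b :: real and V :: "'a set" and E :: "'a set set" and w :: "'a \<Rightarrow> real"
  assumes "b \<ge> 0"
    and "simple_graph V E"
    and "triangle_density V E \<le> ereal b"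
    and "w \<in> V \<rightarrow> {0<..}"
  shows "\<exists>\<mu> :: 'a set pmf. set_pmf \<mu> \<subseteq> independent_sets V E \<and>
           (\<forall>v\<in>V. measure_pmf.prob \<mu> {I. v \<in> I} \<ge> indep_fun (b + 1) (weighted_degree E w v))"
proof -
  have finV: "finite V" using assms(2) by (simp add: simple_graph_def)
  interpret weighted_adjacency V "adj E" b
  proof
    show "adj E x x = 0" for x using edge_distinct[OF assms(2), of x x] by (auto simp: adj_def)
    show "adj E x y = adj E y x" for x y by (simp add: adj_def insert_commute)
    show "(\<Sum>x\<in>B. \<Sum>y\<in>B. \<Sum>z\<in>B. adj E x y * adj E x z * adj E y z * (w x * w y * w z))
        \<le> b * (\<Sum>x\<in>B. \<Sum>y\<in>B. adj E x y * ((w x)\<^sup>2 * w y))"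
      if "B \<subseteq> V" "\<And>x. x \<in> B \<Longrightarrow> w x > 0" for B w
      using that by (rule triangle_bound_of_density[OF assms(2,3)])
  qed (use assms(1) finV in \<open>auto simp: adj_def\<close>)
  have deg: "weighted_degree E w v = deg V w v" if "v \<in> V" for v
  proof -
    have "neighbors E v \<subseteq> V" using assms(2) by (auto simp: neighbors_def simple_graph_def)
    then have "sum w (neighbors E v) = nbr V w v"
      unfolding nbr_def using finV
      by (intro sum.mono_neutral_cong_left) (auto simp: neighbors_def adj_def insert_commute)
    then show ?thesis by (simp add: weighted_degree_def deg_def)
  qed
  have stable: "stable V = independent_sets V E"
    by (auto simp: stable_def independent_sets_def adj_def)
  show ?thesis
  proof (rule coverage_from_weighted_sets[where f = "\<lambda>v. indep_fun (b + 1) (weighted_degree E w v)"])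
    show "finite V" by (rule finV)
    show "finite (independent_sets V E)" using finite_stable[OF finV] by (simp add: stable)
    fix y :: "'a \<Rightarrow> real" assume y: "\<And>v. 0 \<le> y v"
    obtain I where I: "I \<in> stable V" "sum y I = alpha V y" using alpha_attained[OF finV] .
    then have "I \<subseteq> V" by (simp add: stable_def)
    then have "sum y I = (\<Sum>v\<in>V. y v * of_bool (v \<in> I))"
      using finV by (intro sum.mono_neutral_cong_left) auto
    moreover have "rate_sum V y w \<le> alpha V y" using assms(4) y by (intro rate_sum_le_alpha) auto
    ultimately show "\<exists>I\<in>independent_sets V E. (\<Sum>v\<in>V. y v * indep_fun (b + 1) (weighted_degree E w v))
        \<le> (\<Sum>v\<in>V. y v * of_bool (v \<in> I))"
      using I by (intro bexI[of _ I]) (auto simp: rate_sum_def deg stable)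
  qed
qed

end
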